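(* In the general discrete-time setting described in the context, let calibrating functions $q_j>0$, weight functions $\varphi_j\ge0$ and real-valued return functions $g_j$ be given such that (q-f) holds. Then: (a) For any sequence of random variables $\{C_j,\ j\ge0\}$ satisfying (a0)–(a3), the sequence $\{S_n-A_n,\ n\ge1\}$ is a supermartingale with respect to $(\mathfrak W_n)$. Consequently $\mathbb E S_n\le\mathbb E A_n$. (b) To achieve equality $\mathbb E S_n=\mathbb E A_n$: the sequence $\{S_n-A_n\}$ is a martingale for a sequence $\{C_j\}$ satisfying (a0)–(a3) if and only if the following (i) and (ii) hold. (i) For all $j\ge0$ there exists a random variable $D_j=D_j(\boldsymbol\varepsilon_0^j)$ such that, almost surely, (i1) $0\le D_j(\boldsymbol\varepsilon_0^j)<1$; (i2) $1+D_j(\boldsymbol\varepsilon_0^j)g_{j+1}(\boldsymbol\varepsilon_0^j,\varepsilon_{j+1})\ge b$; (i3) $D_j(\boldsymbol\varepsilon_0^j)\int_{\mathcal X_{j+1}}\frac{\varphi_{j+1}(\boldsymbol\varepsilon_0^j,x)f_{j+1}(x|\boldsymbol\varepsilon_0^j)g_{j+1}(\boldsymbol\varepsilon_0^j,x)}{1+D_j(\boldsymbol\varepsilon_0^j)g_{j+1}(\boldsymbol\varepsilon_0^j,x)}\,d\mu_{j+1}(x)=0$, i.e. either (i3A) $\int_{\mathcal X_{j+1}}\frac{\varphi_{j+1}(\boldsymbol\varepsilon_0^j,x)f_{j+1}(x|\boldsymbol\varepsilon_0^j)g_{j+1}(\boldsymbol\varepsilon_0^j,x)}{1+D_j(\boldsymbol\varepsilon_0^j)g_{j+1}(\boldsymbol\varepsilon_0^j,x)}\,d\mu_{j+1}(x)=0$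 or (i3B) $D_j(\boldsymbol\varepsilon_0^j)=0$; and the calibrating functions are given, for $j\ge1$, by (i4) $q_j(\boldsymbol\varepsilon_0^{j-1},\varepsilon_j)=\frac{f_j(\varepsilon_j|\boldsymbol\varepsilon_0^{j-1})}{1+D_{j-1}(\boldsymbol\varepsilon_0^{j-1})g_j(\boldsymbol\varepsilon_0^{j-1},\varepsilon_j)}$. (ii) The strategy $C_j$, $j\ge0$, yields a proportional investment: $C_j(\boldsymbol\varepsilon_0^j)=D_j(\boldsymbol\varepsilon_0^j)Z_j$. Furthermore, the calibrating function $q_j$ from (i4) has $\int_{\mathcal X_j}q_j(\underline x_0^{j-1},x_j)\,d\mu_j(x_j)=1$ (i.e. determines a probability density/mass function) if and only if, in addition to (i3), for all $j\ge1$ $$D_{j-1}(\boldsymbol\varepsilon_0^{j-1})=0\quad\text{or}\quad\int_{\mathcal X_j}\frac{f_j(x_j|\boldsymbol\varepsilon_0^{j-1})g_j(\boldsymbol\varepsilon_0^{j-1},x_j)}{1+D_{j-1}(\boldsymbol\varepsilon_0^{j-1})g_j(\boldsymbol\varepsilon_0^{j-1},x_j)}\,d\mu_j(x_j)=0.$$ (c) Suppose that for all $j\ge0$ there exists a random variable $D_j(\boldsymbol\varepsilon_0^j)$ satisfying (i1)–(i3). Construct random variables $D_j^{O}(\boldsymbol\varepsilon_0^j)$ as follows: set $D_j^{O}(\boldsymbol\varepsilon_0^j)=D_j(\boldsymbol\varepsilon_0^j)$ if (i3A) is fulfilled and $D_j(\boldsymbol\varepsilon_0^j)>0$ (such a value,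 if it exists, is unique), and $D^{O}_j(\boldsymbol\varepsilon_0^j)=0$ otherwise. Then the policies $C^{O}_j=D_j^{O}(\boldsymbol\varepsilon_0^j)Z_j$ yield the expectations $\mathbb E S_n=E_n$ where $$E_n=\sum_{j=1}^n\beta_{j-1},\qquad\beta_{j-1}=\mathbb E\Big\{\varphi_j(\boldsymbol\varepsilon_0^{j-1},\varepsilon_j)\ln\big[1+D^{O}_{j-1}(\boldsymbol\varepsilon_0^{j-1})g_j(\boldsymbol\varepsilon_0^{j-1},\varepsilon_j)\big]\Big\}.$$ It is a maximal value of $\mathbb E S_n$ among the (predictable) strategies satisfying (a1)–(a3). (d) Under the assumptions adopted in (c), suppose that for all $j\ge0$ the random variable $D_j^{O}(\boldsymbol\varepsilon_0^j)>0$ (so (i3A) is fulfilled with $D_j(\boldsymbol\varepsilon_0^j)>0$). Then setting $C^{O}_j=D^{O}_jZ_j$ yields policies that maximise the mean value $\mathbb E S_n$ over the (predictable) strategies satisfying (a1)–(a2).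
   Context: Random trial results $\varepsilon_n$, $n\ge0$, take values in standard measure spaces $(\mathcal X_n,\mathfrak X_n,\mu_n)$ ($\mu_n$ complete, $\sigma$-finite reference measures). The string $\boldsymbol\varepsilon_0^n=(\varepsilon_0,\dots,\varepsilon_n)$ has a joint probability density/mass function with respect to $\prod_{j=0}^n\mu_j$; $f_n(x_n|\underline x_0^{n-1})$ denotes the conditional density/mass function of $\varepsilon_n$ given $\boldsymbol\varepsilon_0^{n-1}=\underline x_0^{n-1}=(x_0,\dots,x_{n-1})$ with respect to $\mu_n$. No further condition on the joint distribution (such as the Markov property) is imposed apart from (q-f) below. $Z_0>0$ is a random initial capital, $\mathfrak W_0=\sigma(Z_0,\varepsilon_0)$, $\mathfrak W_n=\mathfrak W_0\vee\sigma(\boldsymbol\varepsilon_0^n)$; the conditional density of $\varepsilon_n$ given $\mathfrak W_{n-1}$ is $f_n(\cdot|\boldsymbol\varepsilon_0^{n-1})$. For $j\ge1$, given are measurable functions of $(\underline x_0^{j-1},x_j)$: a return function $g_j$ (real-valued), a weight function $\varphi_j\ge0$ and a calibrating function $q_j>0$ (a.s. positive); return and weight functions are not identically $0$. Fix $b>0$. For a strategy $C_0,C_1,\dots$ the capital evolves by $$Z_n=Z_{n-1}+C_{n-1}g_n(\boldsymbol\varepsilon_0^{n-1},\varepsilon_n)=Z_{n-1}\Big(1+\frac{C_{n-1}g_n(\boldsymbol\varepsilon_0^{n-1},\varepsilon_n)}{Z_{n-1}}\Big),\quad n\ge1.$$ Define $$S_n=\sum_{j=1}^n\varphi_j(\boldsymbol\varepsilon_0^{j-1},\varepsilon_j)\ln\frac{Z_j}{Z_{j-1}},\qquad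 A_n=\sum_{j=1}^n\alpha_{j-1},\qquad\alpha_j=\int_{\mathcal X_{j+1}}\varphi_{j+1}(\boldsymbol\varepsilon_0^j,x)f_{j+1}(x|\boldsymbol\varepsilon_0^j)\ln\frac{f_{j+1}(x|\boldsymbol\varepsilon_0^j)}{q_{j+1}(\boldsymbol\varepsilon_0^j,x)}\,d\mu_{j+1}(x).$$ Conditions on a strategy (for all $j\ge0$, almost surely): (a0) $C_j$ is $\mathfrak W_j$-measurable (predictability); (a1) $0\le C_j<Z_j$; (a2) $1+\frac{C_jg_{j+1}(\boldsymbol\varepsilon_0^j,\varepsilon_{j+1})}{Z_j}\ge b$; (a3) $C_j\int_{\mathcal X_{j+1}}\varphi_{j+1}(\boldsymbol\varepsilon_0^j,x)q_{j+1}(\boldsymbol\varepsilon_0^j,x)g_{j+1}(\boldsymbol\varepsilon_0^j,x)\,d\mu_{j+1}(x)=0$. Condition on the calibrating functions: (q-f) for all $j\ge1$, almost surely, $\int_{\mathcal X_j}\varphi_j(\boldsymbol\varepsilon_0^{j-1},x)q_j(\boldsymbol\varepsilon_0^{j-1},x)\,d\mu_j(x)\le\mathbb E[\varphi_j(\boldsymbol\varepsilon_0^{j-1},\varepsilon_j)|\mathfrak W_{j-1}]=\int_{\mathcal X_j}\varphi_j(\boldsymbol\varepsilon_0^{j-1},x)f_j(x|\boldsymbol\varepsilon_0^{j-1})\,d\mu_j(x)$. All integrals and expectations involved are assumed to converge absolutely.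
   Formalization: In (a),(b), (a2) is also required at outcomes of density 0 with φq>0, and n starts at 0 (S_0=A_0=0); (i4) is claimed only where φ>0; "only if" in (b) and uniqueness in (c) assume that, given the past, φfg is not a.e. 0; (a3) in (c) uses q from (i4) with D^O. *)

theory Defs
  imports "HOL-Probability.Probability"
begin

section \<open>Standard measure spaces, conditional densities, martingales\<close>

definition standard_borel :: "'a measure \<Rightarrow> bool" where
  "standard_borel B \<longleftrightarrow> (\<exists>T. completely_metrizable_space T \<and> second_countable T \<and>
     topspace T = space B \<and> sets B = sigma_sets (topspace T) {U. openin T U})"

definition standard_measure_space :: "'a measure \<Rightarrow> bool" where
  "standard_measure_space N \<longleftrightarrow>
     sigma_finite_measure N \<and> (\<exists>B. standard_borel B \<and> N = completion B)"

text \<open>\<open>\<kappa> \<omega>\<close> is a version of the conditional density, with respect to \<open>N\<close>, of the random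
  element \<open>X\<close> given the sub-sigma-algebra \<open>F\<close>.\<close>

definition conditional_density ::
  "'w measure \<Rightarrow> 'w measure \<Rightarrow> 'x measure \<Rightarrow> ('w \<Rightarrow> 'x) \<Rightarrow> ('w \<Rightarrow> 'x \<Rightarrow> real) \<Rightarrow> bool" where
  "conditional_density M F N X \<kappa> \<longleftrightarrow>
     (\<forall>A\<in>sets N. AE \<omega> in M.
        real_cond_exp M F (\<lambda>\<omega>'. indicator A (X \<omega>')) \<omega> = (LINT x:A|N. \<kappa> \<omega> x))"

definition adapted_integrable ::
  "'w measure \<Rightarrow> (nat \<Rightarrow> 'w measure) \<Rightarrow> (nat \<Rightarrow> 'w \<Rightarrow> real) \<Rightarrow> bool" where
  "adapted_integrable M F X \<longleftrightarrow>
     filtration (space M) F \<and> (\<forall>n. subalgebra M (F n)) \<and>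
     (\<forall>n. X n \<in> borel_measurable (F n)) \<and> (\<forall>n. integrable M (X n))"

definition supermartingale ::
  "'w measure \<Rightarrow> (nat \<Rightarrow> 'w measure) \<Rightarrow> (nat \<Rightarrow> 'w \<Rightarrow> real) \<Rightarrow> bool" where
  "supermartingale M F X \<longleftrightarrow> adapted_integrable M F X \<and>
     (\<forall>m n. m \<le> n \<longrightarrow> (AE \<omega> in M. real_cond_exp M (F m) (X n) \<omega> \<le> X m \<omega>))"

definition martingale ::
  "'w measure \<Rightarrow> (nat \<Rightarrow> 'w measure) \<Rightarrow> (nat \<Rightarrow> 'w \<Rightarrow> real) \<Rightarrow> bool" where
  "martingale M F X \<longleftrightarrow> adapted_integrable M F X \<and>
     (\<forall>m n. m \<le> n \<longrightarrow> (AE \<omega> in M. real_cond_exp M (F m) (X n) \<omega> = X m \<omega>))"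


section \<open>The betting model\<close>

text \<open>\<open>trial G n\<close> is the trial result \<open>\<epsilon>\<^sub>n\<close>, with values in the space of \<open>ref G n\<close> (the
  reference measure \<open>\<mu>\<^sub>n\<close>). The functions \<open>cdens G j\<close>, \<open>ret G j\<close>, \<open>wgt G j\<close> (that is \<open>f\<^sub>j\<close>,
  \<open>g\<^sub>j\<close>, \<open>\<phi>\<^sub>j\<close>) are used for \<open>j \<ge> 1\<close> only; their first argument is the string
  \<open>(x\<^sub>0, \<dots>, x\<^bsub>j-1\<^esub>)\<close>, an element of the product over \<open>{..j-1}\<close>, their second argument is
  \<open>x\<^sub>j\<close>. The spaces of the \<open>ref G n\<close> may differ, but are subsets of one type.\<close>

record ('w, 'x) betting =
  prb :: "'w measure"
  ref :: "nat \<Rightarrow> 'x measure"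
  trial :: "nat \<Rightarrow> 'w \<Rightarrow> 'x"
  capital0 :: "'w \<Rightarrow> real"
  cdens :: "nat \<Rightarrow> (nat \<Rightarrow> 'x) \<Rightarrow> 'x \<Rightarrow> real"
  ret :: "nat \<Rightarrow> (nat \<Rightarrow> 'x) \<Rightarrow> 'x \<Rightarrow> real"
  wgt :: "nat \<Rightarrow> (nat \<Rightarrow> 'x) \<Rightarrow> 'x \<Rightarrow> real"
  flr :: real  \<comment> \<open>the constant \<open>b\<close>\<close>

definition strings :: "('w, 'x) betting \<Rightarrow> nat \<Rightarrow> (nat \<Rightarrow> 'x) measure" where
  "strings G n = PiM {..n} (ref G)"

definition past :: "('w, 'x) betting \<Rightarrow> nat \<Rightarrow> 'w \<Rightarrow> nat \<Rightarrow> 'x" where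
  "past G n \<omega> = (\<lambda>i\<in>{..n}. trial G i \<omega>)"

text \<open>The sigma-algebra generated by the initial capital and the first \<open>n + 1\<close> trials.\<close>

definition info :: "('w, 'x) betting \<Rightarrow> nat \<Rightarrow> 'w measure" where
  "info G n = vimage_algebra (space (prb G)) (\<lambda>\<omega>. (capital0 G \<omega>, past G n \<omega>))
     (borel \<Otimes>\<^sub>M strings G n)"

definition step_measurable ::
  "('w, 'x) betting \<Rightarrow> (nat \<Rightarrow> (nat \<Rightarrow> 'x) \<Rightarrow> 'x \<Rightarrow> real) \<Rightarrow> bool" where
  "step_measurable G u \<longleftrightarrow>
     (\<forall>j. (\<lambda>(h, x). u (Suc j) h x) \<in> borel_measurable (strings G j \<Otimes>\<^sub>M ref G (Suc j)))"

definition step_nonneg ::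
  "('w, 'x) betting \<Rightarrow> (nat \<Rightarrow> (nat \<Rightarrow> 'x) \<Rightarrow> 'x \<Rightarrow> real) \<Rightarrow> bool" where
  "step_nonneg G u \<longleftrightarrow>
     (\<forall>j. \<forall>h\<in>space (strings G j). \<forall>x\<in>space (ref G (Suc j)). 0 \<le> u (Suc j) h x)"

definition step_nonzero ::
  "('w, 'x) betting \<Rightarrow> (nat \<Rightarrow> (nat \<Rightarrow> 'x) \<Rightarrow> 'x \<Rightarrow> real) \<Rightarrow> bool" where
  "step_nonzero G u \<longleftrightarrow>
     (\<forall>j. \<exists>h\<in>space (strings G j). \<exists>x\<in>space (ref G (Suc j)). u (Suc j) h x \<noteq> 0)"

locale betting_model = prob_space "prb G" for G :: "('w, 'x) betting" +
  assumes standard: "\<And>n. standard_measure_space (ref G n)"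
    and trial_measurable: "\<And>n. trial G n \<in> prb G \<rightarrow>\<^sub>M ref G n"
    and joint_density: "\<And>n. \<exists>p. distributed (prb G) (strings G n) (past G n) p"
    and capital0_measurable: "capital0 G \<in> borel_measurable (prb G)"
    and capital0_pos: "AE \<omega> in prb G. 0 < capital0 G \<omega>"
    and cdens_measurable: "step_measurable G (cdens G)"
    and cdens_nonneg: "step_nonneg G (cdens G)"
    and cdens_past: "\<And>j. conditional_density (prb G)
        (vimage_algebra (space (prb G)) (past G j) (strings G j)) (ref G (Suc j))
        (trial G (Suc j)) (\<lambda>\<omega>. cdens G (Suc j) (past G j \<omega>))"
    and cdens_info: "\<And>j. conditional_density (prb G) (info G j) (ref G (Suc j))
        (trial G (Suc j)) (\<lambda>\<omega>. cdens G (Suc j) (past G j \<omega>))"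
    and ret_measurable: "step_measurable G (ret G)"
    and ret_nonzero: "step_nonzero G (ret G)"
    and wgt_measurable: "step_measurable G (wgt G)"
    and wgt_nonneg: "step_nonneg G (wgt G)"
    and wgt_nonzero: "step_nonzero G (wgt G)"
    and wgt_integrable:
      "\<And>j. integrable (prb G) (\<lambda>\<omega>. wgt G (Suc j) (past G j \<omega>) (trial G (Suc j) \<omega>))"
    and flr_pos: "0 < flr G"

text \<open>Calibrating functions: \<open>q\<^sub>j\<close> is positive almost surely, that is at the realised trial
  results; off the support of the conditional density it may vanish.\<close>

definition calibrating ::
  "('w, 'x) betting \<Rightarrow> (nat \<Rightarrow> (nat \<Rightarrow> 'x) \<Rightarrow> 'x \<Rightarrow> real) \<Rightarrow> bool" where
  "calibrating G q \<longleftrightarrow> step_measurable G q \<and> step_nonneg G q \<and>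
     (\<forall>j. AE \<omega> in prb G. 0 < q (Suc j) (past G j \<omega>) (trial G (Suc j) \<omega>))"

definition cond_qf ::
  "('w, 'x) betting \<Rightarrow> (nat \<Rightarrow> (nat \<Rightarrow> 'x) \<Rightarrow> 'x \<Rightarrow> real) \<Rightarrow> bool" where
  "cond_qf G q \<longleftrightarrow> (\<forall>j. AE \<omega> in prb G.
     integrable (ref G (Suc j)) (\<lambda>x. wgt G (Suc j) (past G j \<omega>) x * q (Suc j) (past G j \<omega>) x) \<and>
     (LINT x|ref G (Suc j). wgt G (Suc j) (past G j \<omega>) x * q (Suc j) (past G j \<omega>) x)
       \<le> real_cond_exp (prb G) (info G j)
            (\<lambda>\<omega>'. wgt G (Suc j) (past G j \<omega>') (trial G (Suc j) \<omega>')) \<omega>)"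

text \<open>\<open>\<alpha>\<^sub>j\<close> and \<open>A\<^sub>n\<close>. The integrand vanishes where the density does, by its factor \<open>f\<close>.\<close>

definition alpha_integrand ::
  "('w, 'x) betting \<Rightarrow> (nat \<Rightarrow> (nat \<Rightarrow> 'x) \<Rightarrow> 'x \<Rightarrow> real) \<Rightarrow> nat \<Rightarrow> (nat \<Rightarrow> 'x) \<Rightarrow> 'x \<Rightarrow> real" where
  "alpha_integrand G q j h x =
     wgt G (Suc j) h x * cdens G (Suc j) h x * ln (cdens G (Suc j) h x / q (Suc j) h x)"

definition alpha ::
  "('w, 'x) betting \<Rightarrow> (nat \<Rightarrow> (nat \<Rightarrow> 'x) \<Rightarrow> 'x \<Rightarrow> real) \<Rightarrow> nat \<Rightarrow> 'w \<Rightarrow> real" where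
  "alpha G q j \<omega> = (LINT x|ref G (Suc j). alpha_integrand G q j (past G j \<omega>) x)"

definition A_sum ::
  "('w, 'x) betting \<Rightarrow> (nat \<Rightarrow> (nat \<Rightarrow> 'x) \<Rightarrow> 'x \<Rightarrow> real) \<Rightarrow> nat \<Rightarrow> 'w \<Rightarrow> real" where
  "A_sum G q n \<omega> = (\<Sum>j<n. alpha G q j \<omega>)"

definition alpha_converges ::
  "('w, 'x) betting \<Rightarrow> (nat \<Rightarrow> (nat \<Rightarrow> 'x) \<Rightarrow> 'x \<Rightarrow> real) \<Rightarrow> bool" where
  "alpha_converges G q \<longleftrightarrow> (\<forall>j.
     (AE \<omega> in prb G. integrable (ref G (Suc j)) (alpha_integrand G q j (past G j \<omega>))) \<and>
     integrable (prb G) (alpha G q j))"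


section \<open>Strategies\<close>

primrec capital :: "('w, 'x) betting \<Rightarrow> (nat \<Rightarrow> 'w \<Rightarrow> real) \<Rightarrow> nat \<Rightarrow> 'w \<Rightarrow> real" where
  "capital G C 0 \<omega> = capital0 G \<omega>"
| "capital G C (Suc n) \<omega> =
     capital G C n \<omega> + C n \<omega> * ret G (Suc n) (past G n \<omega>) (trial G (Suc n) \<omega>)"

definition S_sum :: "('w, 'x) betting \<Rightarrow> (nat \<Rightarrow> 'w \<Rightarrow> real) \<Rightarrow> nat \<Rightarrow> 'w \<Rightarrow> real" where
  "S_sum G C n \<omega> = (\<Sum>j<n. wgt G (Suc j) (past G j \<omega>) (trial G (Suc j) \<omega>) *
     ln (capital G C (Suc j) \<omega> / capital G C j \<omega>))"

definition S_converges :: "('w, 'x) betting \<Rightarrow> (nat \<Rightarrow> 'w \<Rightarrow> real) \<Rightarrow> bool" where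
  "S_converges G C \<longleftrightarrow> (\<forall>n. integrable (prb G) (S_sum G C n))"

definition cond_a0 :: "('w, 'x) betting \<Rightarrow> (nat \<Rightarrow> 'w \<Rightarrow> real) \<Rightarrow> bool" where
  "cond_a0 G C \<longleftrightarrow> (\<forall>j. C j \<in> borel_measurable (info G j))"

definition cond_a1 :: "('w, 'x) betting \<Rightarrow> (nat \<Rightarrow> 'w \<Rightarrow> real) \<Rightarrow> bool" where
  "cond_a1 G C \<longleftrightarrow> (\<forall>j. AE \<omega> in prb G. 0 \<le> C j \<omega> \<and> C j \<omega> < capital G C j \<omega>)"

definition cond_a2 :: "('w, 'x) betting \<Rightarrow> (nat \<Rightarrow> 'w \<Rightarrow> real) \<Rightarrow> bool" where
  "cond_a2 G C \<longleftrightarrow> (\<forall>j. AE \<omega> in prb G.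
     flr G \<le> 1 + C j \<omega> * ret G (Suc j) (past G j \<omega>) (trial G (Suc j) \<omega>) / capital G C j \<omega>)"

text \<open>\<^const>\<open>cond_a2\<close> constrains the stake only at outcomes charged by the conditional density.
  The next condition demands the same bound at outcomes \<open>x\<close> where the density vanishes but
  \<open>\<phi>\<^sub>j q\<^sub>j\<close> does not; it is void if, for instance, the density is positive, or if \<open>q\<^sub>j\<close>
  vanishes wherever the density does. Without it, a large negative return at an outcome of
  probability 0 makes \<open>cond_a3\<close> compatible with \<open>E S\<^sub>n > E A\<^sub>n\<close>.\<close>

definition cond_a2_null ::
  "('w, 'x) betting \<Rightarrow> (nat \<Rightarrow> (nat \<Rightarrow> 'x) \<Rightarrow> 'x \<Rightarrow> real) \<Rightarrow> (nat \<Rightarrow> 'w \<Rightarrow> real) \<Rightarrow> bool" where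
  "cond_a2_null G q C \<longleftrightarrow> (\<forall>j. AE \<omega> in prb G. AE x in ref G (Suc j).
     cdens G (Suc j) (past G j \<omega>) x = 0 \<and>
     0 < wgt G (Suc j) (past G j \<omega>) x * q (Suc j) (past G j \<omega>) x \<longrightarrow>
       flr G \<le> 1 + C j \<omega> * ret G (Suc j) (past G j \<omega>) x / capital G C j \<omega>)"

text \<open>Integrability is stated explicitly here and in \<open>cond_i3\<close>, because the Bochner integral of
  a non-integrable function is 0 in Isabelle/HOL.\<close>

definition cond_a3 ::
  "('w, 'x) betting \<Rightarrow> (nat \<Rightarrow> (nat \<Rightarrow> 'x) \<Rightarrow> 'x \<Rightarrow> real) \<Rightarrow> (nat \<Rightarrow> 'w \<Rightarrow> real) \<Rightarrow> bool" where
  "cond_a3 G q C \<longleftrightarrow> (\<forall>j. AE \<omega> in prb G.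
     integrable (ref G (Suc j)) (\<lambda>x. wgt G (Suc j) (past G j \<omega>) x *
       q (Suc j) (past G j \<omega>) x * ret G (Suc j) (past G j \<omega>) x) \<and>
     C j \<omega> * (LINT x|ref G (Suc j). wgt G (Suc j) (past G j \<omega>) x *
       q (Suc j) (past G j \<omega>) x * ret G (Suc j) (past G j \<omega>) x) = 0)"


section \<open>Proportional investment\<close>

text \<open>A family \<open>D j\<close> of functions of the string \<open>(x\<^sub>0, \<dots>, x\<^sub>j)\<close>; the random variable \<open>D\<^sub>j\<close> is
  \<open>D j (past G j \<omega>)\<close>.\<close>

definition string_functions :: "('w, 'x) betting \<Rightarrow> (nat \<Rightarrow> (nat \<Rightarrow> 'x) \<Rightarrow> real) \<Rightarrow> bool" where
  "string_functions G D \<longleftrightarrow> (\<forall>j. D j \<in> borel_measurable (strings G j))"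

definition cond_i1 :: "('w, 'x) betting \<Rightarrow> (nat \<Rightarrow> (nat \<Rightarrow> 'x) \<Rightarrow> real) \<Rightarrow> bool" where
  "cond_i1 G D \<longleftrightarrow> (\<forall>j. AE \<omega> in prb G. 0 \<le> D j (past G j \<omega>) \<and> D j (past G j \<omega>) < 1)"

definition cond_i2 :: "('w, 'x) betting \<Rightarrow> (nat \<Rightarrow> (nat \<Rightarrow> 'x) \<Rightarrow> real) \<Rightarrow> bool" where
  "cond_i2 G D \<longleftrightarrow> (\<forall>j. AE \<omega> in prb G.
     flr G \<le> 1 + D j (past G j \<omega>) * ret G (Suc j) (past G j \<omega>) (trial G (Suc j) \<omega>))"

definition i3_integrand ::
  "('w, 'x) betting \<Rightarrow> nat \<Rightarrow> (nat \<Rightarrow> 'x) \<Rightarrow> real \<Rightarrow> 'x \<Rightarrow> real" where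
  "i3_integrand G j h d x =
     wgt G (Suc j) h x * cdens G (Suc j) h x * ret G (Suc j) h x / (1 + d * ret G (Suc j) h x)"

definition cond_i3A :: "('w, 'x) betting \<Rightarrow> nat \<Rightarrow> (nat \<Rightarrow> 'x) \<Rightarrow> real \<Rightarrow> bool" where
  "cond_i3A G j h d \<longleftrightarrow> integrable (ref G (Suc j)) (i3_integrand G j h d) \<and>
     (LINT x|ref G (Suc j). i3_integrand G j h d x) = 0"

definition cond_i3 :: "('w, 'x) betting \<Rightarrow> (nat \<Rightarrow> (nat \<Rightarrow> 'x) \<Rightarrow> real) \<Rightarrow> bool" where
  "cond_i3 G D \<longleftrightarrow> (\<forall>j. AE \<omega> in prb G.
     integrable (ref G (Suc j)) (i3_integrand G j (past G j \<omega>) (D j (past G j \<omega>))) \<and>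
     D j (past G j \<omega>) *
       (LINT x|ref G (Suc j). i3_integrand G j (past G j \<omega>) (D j (past G j \<omega>)) x) = 0)"

text \<open>The calibrating functions \<open>q\<^sub>j = f\<^sub>j / (1 + D\<^bsub>j-1\<^esub> g\<^sub>j)\<close>, used for \<open>j \<ge> 1\<close>.\<close>

definition calib_of ::
  "('w, 'x) betting \<Rightarrow> (nat \<Rightarrow> (nat \<Rightarrow> 'x) \<Rightarrow> real) \<Rightarrow> nat \<Rightarrow> (nat \<Rightarrow> 'x) \<Rightarrow> 'x \<Rightarrow> real" where
  "calib_of G D j h x = cdens G j h x / (1 + D (j - 1) h * ret G j h x)"

text \<open>The values of \<open>q\<^sub>j\<close> at points where the weight \<open>\<phi>\<^sub>j\<close> is 0 influence none of \<open>A\<^sub>n\<close>,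
  \<open>cond_a3\<close>, \<open>cond_qf\<close>, so the formula for \<open>q\<^sub>j\<close> is required only where the weight is positive.
  If \<open>\<phi>\<^sub>j > 0\<close> almost surely, it is required almost surely.\<close>

definition cond_i4 ::
  "('w, 'x) betting \<Rightarrow> (nat \<Rightarrow> (nat \<Rightarrow> 'x) \<Rightarrow> 'x \<Rightarrow> real) \<Rightarrow> (nat \<Rightarrow> (nat \<Rightarrow> 'x) \<Rightarrow> real) \<Rightarrow> bool" where
  "cond_i4 G q D \<longleftrightarrow> (\<forall>j. AE \<omega> in prb G.
     0 < wgt G (Suc j) (past G j \<omega>) (trial G (Suc j) \<omega>) \<longrightarrow>
     q (Suc j) (past G j \<omega>) (trial G (Suc j) \<omega>) =
       calib_of G D (Suc j) (past G j \<omega>) (trial G (Suc j) \<omega>))"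

definition cond_ii ::
  "('w, 'x) betting \<Rightarrow> (nat \<Rightarrow> (nat \<Rightarrow> 'x) \<Rightarrow> real) \<Rightarrow> (nat \<Rightarrow> 'w \<Rightarrow> real) \<Rightarrow> bool" where
  "cond_ii G D C \<longleftrightarrow>
     (\<forall>j. AE \<omega> in prb G. C j \<omega> = D j (past G j \<omega>) * capital G C j \<omega>)"

text \<open>Conditionally on the past, the weighted return does not vanish almost surely. Otherwise
  every fraction \<open>d\<close> satisfies \<open>cond_i3A\<close>, and the stake is not determined by the calibrating
  function and may depend on the initial capital.\<close>

definition nondegenerate :: "('w, 'x) betting \<Rightarrow> bool" where
  "nondegenerate G \<longleftrightarrow> (\<forall>j. AE \<omega> in prb G. \<not> (AE x in ref G (Suc j).
     wgt G (Suc j) (past G j \<omega>) x * cdens G (Suc j) (past G j \<omega>) x *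
       ret G (Suc j) (past G j \<omega>) x = 0))"

definition D_opt ::
  "('w, 'x) betting \<Rightarrow> (nat \<Rightarrow> (nat \<Rightarrow> 'x) \<Rightarrow> real) \<Rightarrow> nat \<Rightarrow> (nat \<Rightarrow> 'x) \<Rightarrow> real" where
  "D_opt G D j h = (if cond_i3A G j h (D j h) \<and> 0 < D j h then D j h else 0)"

text \<open>The policy \<open>C\<^sub>j = D\<^sub>j Z\<^sub>j\<close>. As \<open>Z\<close> itself depends on the policy, its capital is written out
  first; the lemmas below confirm that it is the capital generated by the policy.\<close>

primrec prop_capital ::
  "('w, 'x) betting \<Rightarrow> (nat \<Rightarrow> (nat \<Rightarrow> 'x) \<Rightarrow> real) \<Rightarrow> nat \<Rightarrow> 'w \<Rightarrow> real" where
  "prop_capital G D 0 \<omega> = capital0 G \<omega>"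
| "prop_capital G D (Suc n) \<omega> = prop_capital G D n \<omega> *
     (1 + D n (past G n \<omega>) * ret G (Suc n) (past G n \<omega>) (trial G (Suc n) \<omega>))"

definition prop_policy ::
  "('w, 'x) betting \<Rightarrow> (nat \<Rightarrow> (nat \<Rightarrow> 'x) \<Rightarrow> real) \<Rightarrow> nat \<Rightarrow> 'w \<Rightarrow> real" where
  "prop_policy G D j \<omega> = D j (past G j \<omega>) * prop_capital G D j \<omega>"

lemma capital_prop_policy: "capital G (prop_policy G D) n \<omega> = prop_capital G D n \<omega>"
  by (induction n) (simp_all add: prop_policy_def algebra_simps)

lemma prop_policy_eq:
  "prop_policy G D j \<omega> = D j (past G j \<omega>) * capital G (prop_policy G D) j \<omega>"
  by (simp add: capital_prop_policy prop_policy_def)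

text \<open>\<open>log_term G D j\<close> is \<open>\<phi>\<^bsub>j+1\<^esub> ln (1 + D\<^sub>j g\<^bsub>j+1\<^esub>)\<close>; its expectation is \<open>\<beta>\<^sub>j\<close>.\<close>

definition log_term ::
  "('w, 'x) betting \<Rightarrow> (nat \<Rightarrow> (nat \<Rightarrow> 'x) \<Rightarrow> real) \<Rightarrow> nat \<Rightarrow> 'w \<Rightarrow> real" where
  "log_term G D j \<omega> = wgt G (Suc j) (past G j \<omega>) (trial G (Suc j) \<omega>) *
     ln (1 + D j (past G j \<omega>) * ret G (Suc j) (past G j \<omega>) (trial G (Suc j) \<omega>))"

definition beta :: "('w, 'x) betting \<Rightarrow> (nat \<Rightarrow> (nat \<Rightarrow> 'x) \<Rightarrow> real) \<Rightarrow> nat \<Rightarrow> real" where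
  "beta G D j = (LINT \<omega>|prb G. log_term G D j \<omega>)"

definition E_sum :: "('w, 'x) betting \<Rightarrow> (nat \<Rightarrow> (nat \<Rightarrow> 'x) \<Rightarrow> real) \<Rightarrow> nat \<Rightarrow> real" where
  "E_sum G D n = (\<Sum>j<n. beta G D j)"

definition beta_converges :: "('w, 'x) betting \<Rightarrow> (nat \<Rightarrow> (nat \<Rightarrow> 'x) \<Rightarrow> real) \<Rightarrow> bool" where
  "beta_converges G D \<longleftrightarrow> (\<forall>j. integrable (prb G) (log_term G D j))"

end

theory Submission
  imports Defs
begin

text \<open>
  The inequality behind everything is \<open>ln y \<le> y - 1\<close>, with equality for \<open>y = 1\<close> only. Fix the
  past, write \<open>d = C\<^sub>j / Z\<^sub>j\<close> for the staked fraction of the capital and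
  \<open>r x = 1 + d * g x\<close> for the resulting capital ratio. Given the past, the increment of \<open>S\<close>
  has mean \<open>\<integral> \<phi> f ln r\<close>, and the increment of \<open>A\<close> is \<open>\<integral> \<phi> f ln (f / q)\<close>. Taking
  \<open>y = q r / f\<close>,
  \<open>\<integral> \<phi> f ln r - \<integral> \<phi> f ln (f / q) \<le> \<integral> \<phi> q r - \<integral> \<phi> f = (\<integral> \<phi> q - \<integral> \<phi> f) + d \<integral> \<phi> q g\<close>,
  where the last term vanishes by the balance condition \<open>cond_a3\<close> on the stake and the bracket is
  at most 0 by the condition \<open>cond_qf\<close> on the calibrating function (\<open>log_growth_bound\<close>,
  \<open>growth_le_alpha\<close>). Outcomes with \<open>f = 0\<close> enter only through \<open>\<integral> \<phi> q r\<close>, where the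
  lower bound \<open>r \<ge> b\<close> makes their contribution nonnegative. So \<open>S - A\<close> has nonpositive drift
  and is a supermartingale (\<open>excess_supermartingale\<close>).

  It is a martingale exactly if the drift vanishes at every step, which forces \<open>y = 1\<close>, that is
  \<open>q = f / (1 + d g)\<close> wherever \<open>\<phi> f > 0\<close>. Conversely this formula makes the two integrands
  agree (\<open>proportional_growth\<close>). The stake may depend on the initial capital, whereas \<open>f\<close>, \<open>g\<close> and
  \<open>q\<close> depend on the string of trial results only. If the weighted return is not almost surely 0, the
  formula for \<open>q\<close> can be solved for \<open>d\<close>, which is therefore a function of the string
  (\<open>fraction_implied\<close>, \<open>martingale_proportional\<close>).

  For the optimality of the fractions \<open>D\<close>, the function \<open>q = f / (1 + D g)\<close> is used for
  calibration: for it the increments of \<open>A\<close> are the conditional means of \<open>\<phi> ln (1 + D g)\<close>, so the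
  same inequality bounds the growth of any admissible strategy by that of the proportional one
  (\<open>prop_policy_maximal\<close>). If \<open>D > 0\<close>, then \<open>\<integral> \<phi> q g = 0\<close> already by the choice of \<open>D\<close>, so every
  strategy satisfies the balance condition (\<open>calib_of_a3\<close>).

  These computations need the conditional mean of a function \<open>u (\<omega>, \<epsilon>\<^sub>n)\<close> whose dependence on
  \<open>\<omega>\<close> is through the available information as the integral of \<open>u\<close> against the conditional
  density; the first section supplies this (\<open>cond_exp_graph\<close>).
\<close>

section \<open>Conditional densities\<close>

text \<open>
  Needed to move statements of the form "for almost all \<open>x\<close>" from a measure to its
  restriction to a sub-sigma-algebra, which requires the predicate to be measurable.
\<close>

lemma (in sigma_finite_measure) AE_measurable:
  assumes P: "Measurable.pred (F \<Otimes>\<^sub>M M) (case_prod P)"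
  shows "Measurable.pred F (\<lambda>\<omega>. AE x in M. P \<omega> x)"
proof -
  define S where "S = {z \<in> space (F \<Otimes>\<^sub>M M). \<not> case_prod P z}"
  have S: "S \<in> sets (F \<Otimes>\<^sub>M M)"
    using P unfolding S_def by measurable
  have "(AE x in M. P \<omega> x) \<longleftrightarrow> emeasure M (Pair \<omega> -` S) = 0" if "\<omega> \<in> space F" for \<omega>
  proof (rule AE_iff_measurable[OF sets_Pair1[OF S]])
    show "{x \<in> space M. \<not> P \<omega> x} = Pair \<omega> -` S"
      using that by (auto simp: S_def space_pair_measure)
  qed
  then show ?thesis
    using measurable_emeasure_Pair[OF S] by (subst measurable_cong) auto
qed

text \<open>
  A random element \<open>X\<close> with a conditional density \<open>\<kappa>\<close> given \<open>F\<close>. Conditioning is described by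
  the law of the pair \<open>(\<omega>, X \<omega>)\<close> on the product of \<open>F\<close> and \<open>N\<close>. Keeping \<open>\<omega>\<close> itself as the
  first coordinate admits stakes that are merely \<open>F\<close>-measurable, without representing them as
  functions of the data generating \<open>F\<close>.
\<close>

locale disintegration = prob_space M + N: sigma_finite_measure N
  for M :: "'w measure" and N :: "'x measure" +
  fixes F :: "'w measure" and X :: "'w \<Rightarrow> 'x" and \<kappa> :: "'w \<Rightarrow> 'x \<Rightarrow> real"
  assumes subalgebra_F: "subalgebra M F"
    and X_measurable [measurable]: "X \<in> M \<rightarrow>\<^sub>M N"
    and density_measurable: "case_prod \<kappa> \<in> borel_measurable (F \<Otimes>\<^sub>M N)"
    and density_nonneg: "\<And>\<omega> x. \<omega> \<in> space M \<Longrightarrow> x \<in> space N \<Longrightarrow> 0 \<le> \<kappa> \<omega> x"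
    and density: "conditional_density M F N X \<kappa>"
begin

sublocale finite_measure_subalgebra M F
  by unfold_locales (rule subalgebra_F)

abbreviation "MF \<equiv> restr_to_subalg M F"

sublocale MF: prob_space MF
  by (rule prob_space_restr_to_subalg[OF subalgebra_F prob_space_axioms])

sublocale MFN: pair_sigma_finite MF N ..

lemma space_F: "space F = space M"
  using subalgebra_F by (simp add: subalgebra_def)

lemma sets_F_subset: "A \<in> sets F \<Longrightarrow> A \<in> sets M"
  using subalgebra_F by (auto simp: subalgebra_def)

lemma sets_MFN: "sets (MF \<Otimes>\<^sub>M N) = sets (F \<Otimes>\<^sub>M N)"
  by (rule sets_pair_measure_cong[OF sets_restr_to_subalg[OF subalgebra_F] refl])

lemma space_MFN: "space (MF \<Otimes>\<^sub>M N) = space M \<times> space N"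
  by (simp add: space_pair_measure space_restr_to_subalg)

lemma measurable_MFN: "measurable (MF \<Otimes>\<^sub>M N) B = measurable (F \<Otimes>\<^sub>M N) B"
  by (rule measurable_cong_sets[OF sets_MFN refl])

lemma density_measurable_MFN [measurable]: "case_prod \<kappa> \<in> borel_measurable (MF \<Otimes>\<^sub>M N)"
  using density_measurable by (simp add: measurable_MFN)

lemma graph_measurable [measurable]: "(\<lambda>\<omega>. (\<omega>, X \<omega>)) \<in> M \<rightarrow>\<^sub>M F \<Otimes>\<^sub>M N"
proof (rule measurable_Pair)
  show "(\<lambda>\<omega>. \<omega>) \<in> M \<rightarrow>\<^sub>M F"
    by (rule measurable_from_subalg[OF subalgebra_F measurable_ident_sets[OF refl]])
qed simp

lemma AE_MF_iff:
  assumes "Measurable.pred F P"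
  shows "(AE \<omega> in MF. P \<omega>) \<longleftrightarrow> (AE \<omega> in M. P \<omega>)"
  using AE_restr_to_subalg[OF subalgebra_F] AE_restr_to_subalg2[OF subalgebra_F _ assms] by blast

text \<open>
  Integrability has to be extracted from the value 1 of the integral over the whole space: the
  integral of a function that is not integrable would be 0.
\<close>

lemma density_integral:
  "AE \<omega> in M. integrable N (\<kappa> \<omega>) \<and> (LINT x|N. \<kappa> \<omega> x) = 1"
proof -
  have "AE \<omega> in M. real_cond_exp M F (\<lambda>\<omega>'. indicator (space N) (X \<omega>')) \<omega> = real_cond_exp M F (\<lambda>_. 1) \<omega>"
    by (rule real_cond_exp_cong) (auto simp: measurable_space[OF X_measurable])
  moreover have "AE \<omega> in M. real_cond_exp M F (\<lambda>_. 1) \<omega> = 1"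
    by (rule real_cond_exp_F_meas) auto
  moreover have "AE \<omega> in M. real_cond_exp M F (\<lambda>\<omega>'. indicator (space N) (X \<omega>')) \<omega>
      = (LINT x:space N|N. \<kappa> \<omega> x)"
    using density by (auto simp: conditional_density_def)
  ultimately show ?thesis
  proof eventually_elim
    case (elim \<omega>)
    then have "(LINT x:space N|N. \<kappa> \<omega> x) = 1" by simp
    then have *: "(LINT x|N. \<kappa> \<omega> x) = 1"
      by (simp add: set_integral_space[symmetric] set_lebesgue_integral_def cong: Bochner_Integration.integral_cong)
    then show ?case
      using not_integrable_integral_eq[of N "\<kappa> \<omega>"] by fastforce
  qed
qed

lemma density_nn_integral:
  assumes A: "A \<in> sets N"
  shows "AE \<omega> in M. ennreal (real_cond_exp M F (\<lambda>\<omega>'. indicator A (X \<omega>')) \<omega>)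
    = (\<integral>\<^sup>+x. ennreal (\<kappa> \<omega> x) * indicator A x \<partial>N)"
proof -
  have "AE \<omega> in M. real_cond_exp M F (\<lambda>\<omega>'. indicator A (X \<omega>')) \<omega> = (LINT x:A|N. \<kappa> \<omega> x)"
    using density A by (auto simp: conditional_density_def)
  then show ?thesis
    using density_integral AE_space
  proof eventually_elim
    case (elim \<omega>)
    have "(\<integral>\<^sup>+x. ennreal (\<kappa> \<omega> x) * indicator A x \<partial>N) = (\<integral>\<^sup>+x. ennreal (indicator A x * \<kappa> \<omega> x) \<partial>N)"
      by (intro nn_integral_cong) (auto split: split_indicator)
    also have "\<dots> = ennreal (LINT x|N. indicator A x * \<kappa> \<omega> x)"
      using elim density_nonneg[of \<omega>] integrable_mult_indicator[OF A, of "\<kappa> \<omega>"]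
      by (intro nn_integral_eq_integral) auto
    finally show ?case using elim by (simp add: set_lebesgue_integral_def)
  qed
qed

lemma graph_law_rectangle:
  assumes B: "B \<in> sets F" and A: "A \<in> sets N"
  shows "emeasure (distr M (F \<Otimes>\<^sub>M N) (\<lambda>\<omega>. (\<omega>, X \<omega>))) (B \<times> A)
    = emeasure (density (MF \<Otimes>\<^sub>M N) (\<lambda>z. ennreal (case_prod \<kappa> z))) (B \<times> A)"
proof -
  note B' = sets_F_subset[OF B]
  have BA [measurable]: "B \<times> A \<in> sets (MF \<Otimes>\<^sub>M N)"
    using A B by (simp add: sets_MFN)
  have KBA: "(\<lambda>z. ennreal (case_prod \<kappa> z) * indicator (B \<times> A) z) \<in> borel_measurable (MF \<Otimes>\<^sub>M N)"
    by measurable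
  let ?e = "real_cond_exp M F (\<lambda>\<omega>'. indicator A (X \<omega>'))"
  have int: "integrable M (\<lambda>\<omega>. indicator A (X \<omega>) :: real)"
    using A by (intro integrable_const_bound[where B=1]) auto
  have e0: "AE \<omega> in M. 0 \<le> ?e \<omega>"
    using A by (intro real_cond_exp_pos) auto
  have "emeasure (distr M (F \<Otimes>\<^sub>M N) (\<lambda>\<omega>. (\<omega>, X \<omega>))) (B \<times> A)
      = emeasure M ((\<lambda>\<omega>. (\<omega>, X \<omega>)) -` (B \<times> A) \<inter> space M)"
    using A B by (simp add: emeasure_distr)
  also have "\<dots> = (\<integral>\<^sup>+\<omega>. indicator ((\<lambda>\<omega>. (\<omega>, X \<omega>)) -` (B \<times> A) \<inter> space M) \<omega> \<partial>M)"
    using A B by (intro nn_integral_indicator[symmetric] measurable_sets[OF graph_measurable]) auto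
  also have "\<dots> = (\<integral>\<^sup>+\<omega>. ennreal (indicator B \<omega> * indicator A (X \<omega>)) \<partial>M)"
    by (intro nn_integral_cong) (auto split: split_indicator)
  also have "\<dots> = ennreal (LINT \<omega>|M. indicator B \<omega> * indicator A (X \<omega>))"
    using A B' integrable_mult_indicator[OF B' int] by (intro nn_integral_eq_integral) auto
  also have "(LINT \<omega>|M. indicator B \<omega> * indicator A (X \<omega>)) = (LINT \<omega>|M. indicator B \<omega> * ?e \<omega>)"
    using real_cond_exp_intA[OF int B] by (simp add: set_lebesgue_integral_def)
  also have "ennreal \<dots> = (\<integral>\<^sup>+\<omega>. ennreal (indicator B \<omega> * ?e \<omega>) \<partial>M)"
    using B' integrable_mult_indicator[OF B' real_cond_exp_int(1)[OF int]] e0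
    by (intro nn_integral_eq_integral[symmetric]) auto
  also have "\<dots> = (\<integral>\<^sup>+\<omega>. indicator B \<omega> * (\<integral>\<^sup>+x. ennreal (\<kappa> \<omega> x) * indicator A x \<partial>N) \<partial>M)"
    using density_nn_integral[OF A] 
    by (intro nn_integral_cong_AE) (auto split: split_indicator)
  also have "\<dots> = (\<integral>\<^sup>+\<omega>. indicator B \<omega> * (\<integral>\<^sup>+x. ennreal (\<kappa> \<omega> x) * indicator A x \<partial>N) \<partial>MF)"
  proof (rule nn_integral_subalgebra2[OF subalgebra_F, symmetric])
    note density_measurable[measurable] A[measurable] B[measurable]
    show "(\<lambda>\<omega>. indicator B \<omega> * (\<integral>\<^sup>+x. ennreal (\<kappa> \<omega> x) * indicator A x \<partial>N)) \<in> borel_measurable F"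
      by measurable
  qed
  also have "\<dots> = (\<integral>\<^sup>+\<omega>. (\<integral>\<^sup>+x. ennreal (\<kappa> \<omega> x) * indicator (B \<times> A) (\<omega>, x) \<partial>N) \<partial>MF)"
  proof (intro nn_integral_cong)
    fix \<omega>
    show "indicator B \<omega> * (\<integral>\<^sup>+x. ennreal (\<kappa> \<omega> x) * indicator A x \<partial>N)
        = (\<integral>\<^sup>+x. ennreal (\<kappa> \<omega> x) * indicator (B \<times> A) (\<omega>, x) \<partial>N)"
      by (cases "\<omega> \<in> B") (simp_all add: indicator_times)
  qed
  also have "\<dots> = (\<integral>\<^sup>+z. ennreal (case_prod \<kappa> z) * indicator (B \<times> A) z \<partial>(MF \<Otimes>\<^sub>M N))"
    by (subst N.nn_integral_fst[OF KBA, symmetric]) simp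
  also have "\<dots> = emeasure (density (MF \<Otimes>\<^sub>M N) (\<lambda>z. ennreal (case_prod \<kappa> z))) (B \<times> A)"
    by (intro emeasure_density[symmetric] measurable_compose[OF density_measurable_MFN] BA) simp
  finally show ?thesis .
qed

text \<open>
  Both sides are finite measures that agree on rectangles, hence on the product sigma-algebra.
\<close>

lemma graph_law:
  "distr M (F \<Otimes>\<^sub>M N) (\<lambda>\<omega>. (\<omega>, X \<omega>)) = density (MF \<Otimes>\<^sub>M N) (\<lambda>z. ennreal (case_prod \<kappa> z))"
proof (rule measure_eqI_generator_eq[where A = "\<lambda>_. space F \<times> space N"])
  show "Int_stable {B \<times> A | B A. B \<in> sets F \<and> A \<in> sets N}"
    by (rule Int_stable_pair_measure_generator)
  show "{B \<times> A | B A. B \<in> sets F \<and> A \<in> sets N} \<subseteq> Pow (space F \<times> space N)"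
    by (rule pair_measure_closed)
  show "emeasure (distr M (F \<Otimes>\<^sub>M N) (\<lambda>\<omega>. (\<omega>, X \<omega>))) (space F \<times> space N) \<noteq> \<infinity>" for i :: nat
  proof -
    interpret D: prob_space "distr M (F \<Otimes>\<^sub>M N) (\<lambda>\<omega>. (\<omega>, X \<omega>))"
      by (rule prob_space_distr) simp
    show ?thesis using D.emeasure_finite by simp
  qed
  show "sets (density (MF \<Otimes>\<^sub>M N) (\<lambda>z. ennreal (case_prod \<kappa> z))) = sigma_sets (space F \<times> space N)
      {B \<times> A | B A. B \<in> sets F \<and> A \<in> sets N}"
    unfolding sets_density sets_MFN by (rule sets_pair_measure)
qed (auto simp: graph_law_rectangle sets_pair_measure)

text \<open>
  What holds almost surely at the realised value of \<open>X\<close> holds at almost every point charged by the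
  conditional density. All conditions on returns and calibrating functions at realised results
  are transferred in this way.
\<close>

lemma AE_graph_iff:
  assumes P: "Measurable.pred (F \<Otimes>\<^sub>M N) (case_prod P)"
  shows "(AE \<omega> in M. P \<omega> (X \<omega>)) \<longleftrightarrow> (AE \<omega> in M. AE x in N. 0 < \<kappa> \<omega> x \<longrightarrow> P \<omega> x)"
proof -
  note density_measurable[measurable] P[measurable]
  have P': "Measurable.pred (F \<Otimes>\<^sub>M N) (\<lambda>z. P (fst z) (snd z))"
    using P by (simp add: case_prod_unfold)
  have Q: "Measurable.pred (F \<Otimes>\<^sub>M N) (\<lambda>z. 0 < \<kappa> (fst z) (snd z) \<longrightarrow> P (fst z) (snd z))"
    using density_measurable P by (simp add: case_prod_unfold)
  have Q': "Measurable.pred F (\<lambda>\<omega>. AE x in N. 0 < \<kappa> \<omega> x \<longrightarrow> P \<omega> x)"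
    using Q by (intro N.AE_measurable) (simp add: case_prod_unfold)
  have D: "(\<lambda>z. ennreal (case_prod \<kappa> z)) \<in> borel_measurable (MF \<Otimes>\<^sub>M N)"
    by measurable
  have "(AE \<omega> in M. P \<omega> (X \<omega>)) \<longleftrightarrow>
      (AE z in distr M (F \<Otimes>\<^sub>M N) (\<lambda>\<omega>. (\<omega>, X \<omega>)). P (fst z) (snd z))"
    using P' by (subst AE_distr_iff) (auto simp: pred_def)
  also have "\<dots> \<longleftrightarrow> (AE z in MF \<Otimes>\<^sub>M N. 0 < \<kappa> (fst z) (snd z) \<longrightarrow> P (fst z) (snd z))"
    unfolding graph_law AE_density[OF D] by (simp add: case_prod_unfold)
  also have "\<dots> \<longleftrightarrow> (AE \<omega> in MF. AE x in N. 0 < \<kappa> \<omega> x \<longrightarrow> P \<omega> x)"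
    using Q by (intro MFN.AE_pair_iff[symmetric]) (simp only: measurable_MFN[symmetric] pred_def)
  also have "\<dots> \<longleftrightarrow> (AE \<omega> in M. AE x in N. 0 < \<kappa> \<omega> x \<longrightarrow> P \<omega> x)"
    by (rule AE_MF_iff[OF Q'])
  finally show ?thesis .
qed

text \<open>
  By the law of the pair \<open>(\<omega>, X \<omega>)\<close> and Fubini's theorem, the mean of \<open>u \<omega> (X \<omega>)\<close> over a
  set in \<open>F\<close> is the mean over that set of \<open>\<integral> u \<omega> x * \<kappa> \<omega> x\<close>. This
  characterises the conditional expectation.
\<close>

lemma cond_exp_graph:
  assumes u: "case_prod u \<in> borel_measurable (F \<Otimes>\<^sub>M N)"
    and int: "integrable M (\<lambda>\<omega>. u \<omega> (X \<omega>))"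
  shows "AE \<omega> in M. integrable N (\<lambda>x. u \<omega> x * \<kappa> \<omega> x)"
    and "AE \<omega> in M. real_cond_exp M F (\<lambda>\<omega>. u \<omega> (X \<omega>)) \<omega> = (LINT x|N. u \<omega> x * \<kappa> \<omega> x)"
proof -
  note density_measurable[measurable] u[measurable]
  let ?G = "distr M (F \<Otimes>\<^sub>M N) (\<lambda>\<omega>. (\<omega>, X \<omega>))"
  have nonneg: "AE z in MF \<Otimes>\<^sub>M N. 0 \<le> case_prod \<kappa> z"
    by (rule AE_I2) (auto simp: space_MFN density_nonneg)
  have transfer: "integrable (MF \<Otimes>\<^sub>M N) (\<lambda>(\<omega>, x). v \<omega> x * \<kappa> \<omega> x)"
      "(LINT \<omega>|MF. LINT x|N. v \<omega> x * \<kappa> \<omega> x) = (LINT \<omega>|M. v \<omega> (X \<omega>))"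
    if v: "case_prod v \<in> borel_measurable (F \<Otimes>\<^sub>M N)" and vi: "integrable M (\<lambda>\<omega>. v \<omega> (X \<omega>))" for v
  proof -
    have v': "case_prod v \<in> borel_measurable (MF \<Otimes>\<^sub>M N)"
      using v by (simp add: measurable_MFN)
    have "integrable ?G (case_prod v)"
      using vi v by (subst integrable_distr_eq) auto
    then show 1: "integrable (MF \<Otimes>\<^sub>M N) (\<lambda>(\<omega>, x). v \<omega> x * \<kappa> \<omega> x)"
      unfolding graph_law using nonneg v'
      by (subst (asm) integrable_density) (auto simp: case_prod_unfold mult.commute)
    have "(LINT \<omega>|M. v \<omega> (X \<omega>)) = integral\<^sup>L ?G (case_prod v)"
      using v by (subst integral_distr) auto
    also have "\<dots> = (LINT z|(MF \<Otimes>\<^sub>M N). (case z of (\<omega>, x) \<Rightarrow> v \<omega> x * \<kappa> \<omega> x))"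
      unfolding graph_law using nonneg v'
      by (subst integral_density) (auto simp: case_prod_unfold mult.commute)
    finally show "(LINT \<omega>|MF. LINT x|N. v \<omega> x * \<kappa> \<omega> x) = (LINT \<omega>|M. v \<omega> (X \<omega>))"
      using MFN.integral_fst'[OF 1] by simp
  qed
  note tu = transfer[OF u int]
  show "AE \<omega> in M. integrable N (\<lambda>x. u \<omega> x * \<kappa> \<omega> x)"
    using MFN.AE_integrable_fst'[OF tu(1)] AE_restr_to_subalg[OF subalgebra_F] by auto
  let ?m = "\<lambda>\<omega>. LINT x|N. u \<omega> x * \<kappa> \<omega> x"
  have mF [measurable]: "?m \<in> borel_measurable F"
    by measurable
  have mi: "integrable MF ?m"
    using MFN.integrable_fst'[OF tu(1)] by simp
  then have mi': "integrable M ?m"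
    by (rule integrable_from_subalg[OF subalgebra_F])
  show "AE \<omega> in M. real_cond_exp M F (\<lambda>\<omega>. u \<omega> (X \<omega>)) \<omega> = ?m \<omega>"
  proof (rule real_cond_exp_charact[OF _ int mi' mF])
    fix A assume A: "A \<in> sets F"
    note [measurable] = A
    have vi: "integrable M (\<lambda>\<omega>. indicator A \<omega> * u \<omega> (X \<omega>))"
      using integrable_mult_indicator[OF sets_F_subset[OF A] int] by simp
    have "(\<integral>\<omega>\<in>A. u \<omega> (X \<omega>) \<partial>M) = (LINT \<omega>|M. indicator A \<omega> * u \<omega> (X \<omega>))"
      by (simp add: set_lebesgue_integral_def)
    also have "\<dots> = (LINT \<omega>|MF. LINT x|N. indicator A \<omega> * u \<omega> x * \<kappa> \<omega> x)"
      by (rule transfer(2)[symmetric]) (use vi in measurable)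
    also have "\<dots> = (LINT \<omega>|MF. indicator A \<omega> * ?m \<omega>)"
      by (simp add: mult.assoc)
    also have "\<dots> = (LINT \<omega>|M. indicator A \<omega> * ?m \<omega>)"
      by (rule integral_subalgebra2[OF subalgebra_F]) measurable
    finally show "(\<integral>\<omega>\<in>A. u \<omega> (X \<omega>) \<partial>M) = (\<integral>\<omega>\<in>A. ?m \<omega> \<partial>M)"
      by (simp add: set_lebesgue_integral_def)
  qed
qed

end

section \<open>The logarithmic inequality\<close>

text \<open>
  Integrate \<open>ln y \<le> y - 1\<close> for \<open>y = q r / f\<close> with weight \<open>w f\<close>. Where \<open>f\<close> vanishes the
  left-hand integrands are 0, so that \<open>w q r\<close> must be nonnegative there. In the case of equality
  the nonnegative gap between the two integrands is 0 almost everywhere, and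
  \<open>ln y = y - 1\<close> for \<open>y = 1\<close> only.
\<close>

lemma log_growth_bound:
  fixes w f q r :: "'x \<Rightarrow> real"
  assumes w: "AE x in N. 0 \<le> w x" and f: "AE x in N. 0 \<le> f x"
    and pos: "AE x in N. 0 < f x \<longrightarrow> 0 < q x \<and> 0 < r x"
    and null: "AE x in N. f x = 0 \<longrightarrow> 0 \<le> w x * q x * r x"
    and int: "integrable N (\<lambda>x. w x * f x)" "integrable N (\<lambda>x. w x * q x * r x)"
      "integrable N (\<lambda>x. w x * f x * ln (r x))" "integrable N (\<lambda>x. w x * f x * ln (f x / q x))"
  shows "(LINT x|N. w x * f x * ln (r x)) - (LINT x|N. w x * f x * ln (f x / q x))
      \<le> (LINT x|N. w x * q x * r x) - (LINT x|N. w x * f x)"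
    and "(LINT x|N. w x * f x * ln (r x)) - (LINT x|N. w x * f x * ln (f x / q x))
      = (LINT x|N. w x * q x * r x) - (LINT x|N. w x * f x) \<Longrightarrow> AE x in N. (0 < w x * f x \<longrightarrow> q x * r x = f x) \<and>
      (f x = 0 \<longrightarrow> w x * q x * r x = 0)"
proof -
  let ?L = "(LINT x|N. w x * f x * ln (r x)) - (LINT x|N. w x * f x * ln (f x / q x))"
    and ?R = "(LINT x|N. w x * q x * r x) - (LINT x|N. w x * f x)"
  define gap where "gap x = (w x * q x * r x - w x * f x) -
      (w x * f x * ln (r x) - w x * f x * ln (f x / q x))" for x
  have gap_eq: "gap x = w x * f x * (q x * r x / f x - 1 - ln (q x * r x / f x))"
    if "0 < f x" "0 < q x" "0 < r x" for x
    using that by (simp add: gap_def ln_div ln_mult field_simps)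
  have gap_nonneg: "AE x in N. 0 \<le> gap x"
    using w f pos null
  proof eventually_elim
    case (elim x)
    show ?case
    proof (cases "f x = 0")
      case False
      with elim have p: "0 < f x" "0 < q x" "0 < r x" by auto
      then have "ln (q x * r x / f x) \<le> q x * r x / f x - 1"
        by (intro ln_le_minus_one) simp
      then show ?thesis using p elim by (simp add: gap_eq)
    qed (use elim in \<open>simp add: gap_def\<close>)
  qed
  have gap_int: "integrable N gap"
    unfolding gap_def using int by (intro Bochner_Integration.integrable_diff)
  have gap_integral: "integral\<^sup>L N gap = ?R - ?L"
    unfolding gap_def using int by simp
  show "?L \<le> ?R"
    using integral_nonneg_AE[OF gap_nonneg] gap_integral by simp
  assume "?L = ?R"
  then have "AE x in N. gap x = 0"
    using gap_integral integral_nonneg_eq_0_iff_AE[OF gap_int gap_nonneg] by simp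
  then show "AE x in N. (0 < w x * f x \<longrightarrow> q x * r x = f x) \<and> (f x = 0 \<longrightarrow> w x * q x * r x = 0)"
    using w f pos
  proof eventually_elim
    case (elim x)
    have "q x * r x = f x" if wf: "0 < w x * f x"
    proof -
      have p: "0 < f x" "0 < q x" "0 < r x" using elim wf by (auto simp: zero_less_mult_iff)
      then have "w x * f x * (q x * r x / f x - 1 - ln (q x * r x / f x)) = 0"
        using elim(1) by (simp only: gap_eq)
      then have "q x * r x / f x - 1 - ln (q x * r x / f x) = 0"
        using wf by (metis mult_eq_0_iff less_irrefl)
      then have "ln (q x * r x / f x) = q x * r x / f x - 1"
        by simp
      then have "q x * r x / f x = 1"
        using p by (intro ln_eq_minus_one) simp_all
      then show ?thesis using p by simp
    qed
    moreover have "w x * q x * r x = 0" if "f x = 0"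
      using elim that by (simp add: gap_def)
    ultimately show ?case by blast
  qed
qed

section \<open>Martingales from one-step increments\<close>

text \<open>
  The tower property reduces conditional means over several steps to those of single increments.
\<close>

lemma (in prob_space) cond_exp_increment:
  assumes X: "adapted_integrable M F X" and le: "m \<le> n"
  shows "AE \<omega> in M. real_cond_exp M (F m) (X (Suc n)) \<omega> = real_cond_exp M (F m) (X n) \<omega> +
    real_cond_exp M (F m) (real_cond_exp M (F n) (\<lambda>\<omega>. X (Suc n) \<omega> - X n \<omega>)) \<omega>"
proof -
  have sub: "subalgebra M (F k)" for k using X by (simp add: adapted_integrable_def)
  have subnm: "subalgebra (F n) (F m)"
    using X le by (auto simp: adapted_integrable_def filtration_def subalgebra_def)
  interpret Fm: finite_measure_subalgebra M "F m" by unfold_locales (rule sub)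
  have [simp]: "integrable M (X k)" for k using X by (simp add: adapted_integrable_def)
  have "AE \<omega> in M. real_cond_exp M (F m) (\<lambda>\<omega>. X n \<omega> + (X (Suc n) \<omega> - X n \<omega>)) \<omega> =
      real_cond_exp M (F m) (X n) \<omega> + real_cond_exp M (F m) (\<lambda>\<omega>. X (Suc n) \<omega> - X n \<omega>) \<omega>"
    by (rule Fm.real_cond_exp_add) auto
  moreover have "AE \<omega> in M. real_cond_exp M (F m) (real_cond_exp M (F n) (\<lambda>\<omega>. X (Suc n) \<omega> - X n \<omega>)) \<omega>
      = real_cond_exp M (F m) (\<lambda>\<omega>. X (Suc n) \<omega> - X n \<omega>) \<omega>"
    by (rule Fm.real_cond_exp_nested_subalg[OF sub subnm]) auto
  ultimately show ?thesis by eventually_elim simp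
qed

lemma (in prob_space) supermartingale_increments:
  assumes X: "adapted_integrable M F X"
    and inc: "\<And>n. AE \<omega> in M. real_cond_exp M (F n) (\<lambda>\<omega>. X (Suc n) \<omega> - X n \<omega>) \<omega> \<le> 0"
  shows "supermartingale M F X"
  unfolding supermartingale_def
proof (intro conjI allI impI X)
  fix m n :: nat assume "m \<le> n"
  have sub: "subalgebra M (F k)" for k using X by (simp add: adapted_integrable_def)
  interpret Fm: finite_measure_subalgebra M "F m" by unfold_locales (rule sub)
  have [simp]: "integrable M (X k)" for k using X by (simp add: adapted_integrable_def)
  show "AE \<omega> in M. real_cond_exp M (F m) (X n) \<omega> \<le> X m \<omega>"
    using \<open>m \<le> n\<close>
  proof (induction n rule: dec_induct)
    case base
    have "AE \<omega> in M. real_cond_exp M (F m) (X m) \<omega> = X m \<omega>"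
      using X by (intro Fm.real_cond_exp_F_meas) (auto simp: adapted_integrable_def)
    then show ?case by eventually_elim simp
  next
    case (step n)
    interpret Fn: finite_measure_subalgebra M "F n" by unfold_locales (rule sub)
    have "AE \<omega> in M. real_cond_exp M (F m) (real_cond_exp M (F n) (\<lambda>\<omega>. X (Suc n) \<omega> - X n \<omega>)) \<omega>
        \<le> real_cond_exp M (F m) (\<lambda>_. 0) \<omega>"
      by (rule Fm.real_cond_exp_mono) (auto intro: inc Fn.real_cond_exp_int)
    moreover have "AE \<omega> in M. real_cond_exp M (F m) (\<lambda>_. 0) \<omega> = 0"
      by (rule Fm.real_cond_exp_F_meas) auto
    ultimately show ?case
      using step.IH cond_exp_increment[OF X \<open>m \<le> n\<close>] by eventually_elim simp
  qed
qed

lemma (in prob_space) martingale_increments: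
  assumes X: "adapted_integrable M F X"
  shows "martingale M F X \<longleftrightarrow>
    (\<forall>n. AE \<omega> in M. real_cond_exp M (F n) (\<lambda>\<omega>. X (Suc n) \<omega> - X n \<omega>) \<omega> = 0)"
proof -
  have sub: "subalgebra M (F k)" for k using X by (simp add: adapted_integrable_def)
  have FM: "finite_measure_subalgebra M (F k)" for k
    by (intro finite_measure_subalgebra.intro finite_measure_subalgebra_axioms.intro sub) unfold_locales
  have int [simp]: "integrable M (X k)" for k using X by (simp add: adapted_integrable_def)
  have same: "AE \<omega> in M. real_cond_exp M (F m) (X m) \<omega> = X m \<omega>" for m
  proof -
    interpret Fm: finite_measure_subalgebra M "F m" by (rule FM)
    show ?thesis using X by (intro Fm.real_cond_exp_F_meas) (auto simp: adapted_integrable_def)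
  qed
  show ?thesis
  proof
    assume mart: "martingale M F X"
    show "\<forall>n. AE \<omega> in M. real_cond_exp M (F n) (\<lambda>\<omega>. X (Suc n) \<omega> - X n \<omega>) \<omega> = 0"
    proof
      fix n
      interpret Fn: finite_measure_subalgebra M "F n" by (rule FM)
      have "AE \<omega> in M. real_cond_exp M (F n) (\<lambda>\<omega>. X (Suc n) \<omega> - X n \<omega>) \<omega> =
          real_cond_exp M (F n) (X (Suc n)) \<omega> - real_cond_exp M (F n) (X n) \<omega>"
        by (rule Fn.real_cond_exp_diff) auto
      moreover have "AE \<omega> in M. real_cond_exp M (F n) (X (Suc n)) \<omega> = X n \<omega>"
        using mart by (simp add: martingale_def)
      ultimately show "AE \<omega> in M. real_cond_exp M (F n) (\<lambda>\<omega>. X (Suc n) \<omega> - X n \<omega>) \<omega> = 0"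
        using same[of n] by eventually_elim simp
    qed
  next
    assume inc: "\<forall>n. AE \<omega> in M. real_cond_exp M (F n) (\<lambda>\<omega>. X (Suc n) \<omega> - X n \<omega>) \<omega> = 0"
    show "martingale M F X"
      unfolding martingale_def
    proof (intro conjI allI impI X)
      fix m n :: nat assume "m \<le> n"
      interpret Fm: finite_measure_subalgebra M "F m" by (rule FM)
      show "AE \<omega> in M. real_cond_exp M (F m) (X n) \<omega> = X m \<omega>"
        using \<open>m \<le> n\<close>
      proof (induction n rule: dec_induct)
        case base
        show ?case by (rule same)
      next
        case (step n)
        interpret Fn: finite_measure_subalgebra M "F n" by (rule FM)
        have "AE \<omega> in M. real_cond_exp M (F m) (real_cond_exp M (F n) (\<lambda>\<omega>. X (Suc n) \<omega> - X n \<omega>)) \<omega>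
            = real_cond_exp M (F m) (\<lambda>_. 0) \<omega>"
          using inc Fn.real_cond_exp_int(1)[of "\<lambda>\<omega>. X (Suc n) \<omega> - X n \<omega>"]
          by (intro Fm.real_cond_exp_cong) auto
        moreover have "AE \<omega> in M. real_cond_exp M (F m) (\<lambda>_. 0) \<omega> = 0"
          by (rule Fm.real_cond_exp_F_meas) auto
        ultimately show ?case
          using step.IH cond_exp_increment[OF X \<open>m \<le> n\<close>] by eventually_elim simp
      qed
    qed
  qed
qed

section \<open>One step of the betting model\<close>

definition fraction :: "('w, 'x) betting \<Rightarrow> (nat \<Rightarrow> 'w \<Rightarrow> real) \<Rightarrow> nat \<Rightarrow> 'w \<Rightarrow> real" where
  "fraction G C j \<omega> = C j \<omega> / capital G C j \<omega>"

text \<open>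
  The conditional mean, given the string \<open>h\<close>, of the weighted logarithmic return from staking the
  fraction \<open>d\<close> of the capital.
\<close>

definition growth :: "('w, 'x) betting \<Rightarrow> nat \<Rightarrow> (nat \<Rightarrow> 'x) \<Rightarrow> real \<Rightarrow> real" where
  "growth G j h d = (LINT x|ref G (Suc j).
     wgt G (Suc j) h x * cdens G (Suc j) h x * ln (1 + d * ret G (Suc j) h x))"

context betting_model
begin

abbreviation "M \<equiv> prb G"
abbreviation "wt j \<omega> x \<equiv> wgt G (Suc j) (past G j \<omega>) x"
abbreviation "dens j \<omega> x \<equiv> cdens G (Suc j) (past G j \<omega>) x"
abbreviation "rt j \<omega> x \<equiv> ret G (Suc j) (past G j \<omega>) x"

lemma ref_sigma_finite: "sigma_finite_measure (ref G n)"
  using standard by (simp add: standard_measure_space_def)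

lemma past_measurable: "past G n \<in> M \<rightarrow>\<^sub>M strings G n"
  unfolding past_def[abs_def] strings_def by (intro measurable_restrict trial_measurable)

lemma space_info: "space (info G n) = space M"
  by (simp add: info_def)

lemma capital0_past_space:
  "(\<lambda>\<omega>. (capital0 G \<omega>, past G n \<omega>)) \<in> space M \<rightarrow> space (borel \<Otimes>\<^sub>M strings G n)"
  using measurable_space[OF past_measurable] by (auto simp: space_pair_measure)

lemma capital0_past_info:
  "(\<lambda>\<omega>. (capital0 G \<omega>, past G n \<omega>)) \<in> info G n \<rightarrow>\<^sub>M borel \<Otimes>\<^sub>M strings G n"
  unfolding info_def by (rule measurable_vimage_algebra1[OF capital0_past_space])

lemma capital0_info: "capital0 G \<in> borel_measurable (info G n)"
  using measurable_compose[OF capital0_past_info measurable_fst] by simp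

lemma past_info: "m \<le> n \<Longrightarrow> past G m \<in> info G n \<rightarrow>\<^sub>M strings G m"
proof -
  assume "m \<le> n"
  have "past G n \<in> info G n \<rightarrow>\<^sub>M strings G n"
    using measurable_compose[OF capital0_past_info measurable_snd] by simp
  then have "(\<lambda>\<omega>. restrict (past G n \<omega>) {..m}) \<in> info G n \<rightarrow>\<^sub>M strings G m"
    unfolding strings_def
    by (rule measurable_compose[OF _ measurable_restrict_subset]) (use \<open>m \<le> n\<close> in auto)
  moreover have "restrict (past G n \<omega>) {..m} = past G m \<omega>" for \<omega>
    using \<open>m \<le> n\<close> by (auto simp: past_def restrict_def)
  ultimately show ?thesis by simp
qed

lemma trial_info: "trial G n \<in> info G n \<rightarrow>\<^sub>M ref G n"
proof -
  have "(\<lambda>\<omega>. past G n \<omega> n) \<in> info G n \<rightarrow>\<^sub>M ref G n"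
    using past_info[of n n] unfolding strings_def
    by (rule measurable_compose[OF _ measurable_component_singleton]) auto
  then show ?thesis by (simp add: past_def)
qed

lemma subalgebra_info: "subalgebra M (info G n)"
proof -
  have "(\<lambda>\<omega>. (capital0 G \<omega>, past G n \<omega>)) \<in> M \<rightarrow>\<^sub>M borel \<Otimes>\<^sub>M strings G n"
    using capital0_measurable past_measurable by simp
  then have "(\<lambda>\<omega>. \<omega>) \<in> M \<rightarrow>\<^sub>M info G n"
    unfolding info_def by (intro measurable_vimage_algebra2) auto
  then have "sets (info G n) \<subseteq> sets M"
    using measurable_sets[of "\<lambda>\<omega>. \<omega>" M "info G n"] sets.sets_into_space[of _ "info G n"]
    by (fastforce simp: space_info Int_absorb2)
  then show ?thesis by (simp add: subalgebra_def space_info)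
qed

lemma filtration_info: "filtration (space M) (info G)"
proof
  fix m n :: nat assume "m \<le> n"
  have "(\<lambda>\<omega>. (capital0 G \<omega>, past G m \<omega>)) \<in> info G n \<rightarrow>\<^sub>M borel \<Otimes>\<^sub>M strings G m"
    using capital0_info past_info[OF \<open>m \<le> n\<close>] by simp
  then have "(\<lambda>\<omega>. \<omega>) \<in> info G n \<rightarrow>\<^sub>M info G m"
    unfolding info_def[of G m] by (intro measurable_vimage_algebra2) (auto simp: space_info)
  then show "sets (info G m) \<subseteq> sets (info G n)"
    using measurable_sets[of "\<lambda>\<omega>. \<omega>" "info G n" "info G m"] sets.sets_into_space[of _ "info G m"]
    by (fastforce simp: space_info Int_absorb2)
qed (rule space_info)

lemma measurable_info_M: "u \<in> measurable (info G n) B \<Longrightarrow> u \<in> measurable M B"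
  by (rule measurable_from_subalg[OF subalgebra_info])

lemma measurable_info_mono: "m \<le> n \<Longrightarrow> u \<in> measurable (info G m) B \<Longrightarrow> u \<in> measurable (info G n) B"
  by (rule measurable_from_subalg)
    (use filtration_info in \<open>auto simp: subalgebra_def filtration_def space_info\<close>)

lemma step_joint:
  assumes "step_measurable G u"
  shows "(\<lambda>(\<omega>, x). u (Suc j) (past G j \<omega>) x) \<in> borel_measurable (info G j \<Otimes>\<^sub>M ref G (Suc j))"
proof -
  have u: "(\<lambda>(h, x). u (Suc j) h x) \<in> borel_measurable (strings G j \<Otimes>\<^sub>M ref G (Suc j))"
    using assms by (simp add: step_measurable_def)
  have "(\<lambda>z. (past G j (fst z), snd z)) \<in> info G j \<Otimes>\<^sub>M ref G (Suc j) \<rightarrow>\<^sub>M strings G j \<Otimes>\<^sub>M ref G (Suc j)"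
    by (intro measurable_Pair measurable_snd measurable_compose[OF measurable_fst past_info]) simp
  from measurable_compose[OF this u] show ?thesis by (simp add: case_prod_unfold)
qed

lemma step_section:
  assumes "step_measurable G u" "\<omega> \<in> space M"
  shows "(\<lambda>x. u (Suc j) (past G j \<omega>) x) \<in> borel_measurable (ref G (Suc j))"
  using measurable_Pair2[OF step_joint[OF assms(1), of j], of \<omega>] assms(2) by (simp add: space_info)

lemma step_realised:
  assumes "step_measurable G u"
  shows "(\<lambda>\<omega>. u (Suc j) (past G j \<omega>) (trial G (Suc j) \<omega>)) \<in> borel_measurable (info G (Suc j))"
proof -
  have u: "(\<lambda>(h, x). u (Suc j) h x) \<in> borel_measurable (strings G j \<Otimes>\<^sub>M ref G (Suc j))"
    using assms by (simp add: step_measurable_def)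
  have "(\<lambda>\<omega>. (past G j \<omega>, trial G (Suc j) \<omega>)) \<in> info G (Suc j) \<rightarrow>\<^sub>M strings G j \<Otimes>\<^sub>M ref G (Suc j)"
    using past_info[of j "Suc j"] trial_info[of "Suc j"] by simp
  from measurable_compose[OF this u] show ?thesis by simp
qed

lemma step_nonneg_at:
  assumes "step_nonneg G u" "\<omega> \<in> space M" "x \<in> space (ref G (Suc j))"
  shows "0 \<le> u (Suc j) (past G j \<omega>) x"
  using assms measurable_space[OF past_measurable[of j]] by (auto simp: step_nonneg_def)

lemmas dens_nonneg = step_nonneg_at[OF cdens_nonneg]
lemmas wt_nonneg = step_nonneg_at[OF wgt_nonneg]
lemmas section_measurable = step_section[OF cdens_measurable] step_section[OF wgt_measurable]
  step_section[OF ret_measurable]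
lemmas joint_measurable = step_joint[OF cdens_measurable] step_joint[OF wgt_measurable]
  step_joint[OF ret_measurable]

lemma disintegration_step:
  "disintegration M (ref G (Suc j)) (info G j) (trial G (Suc j)) (dens j)"
proof (intro disintegration.intro disintegration_axioms.intro)
  show "prob_space M" by (rule prob_space_axioms)
  show "sigma_finite_measure (ref G (Suc j))" by (rule ref_sigma_finite)
  show "case_prod (dens j) \<in> borel_measurable (info G j \<Otimes>\<^sub>M ref G (Suc j))"
    by (rule step_joint[OF cdens_measurable])
  show "conditional_density M (info G j) (ref G (Suc j)) (trial G (Suc j)) (dens j)"
    by (rule cdens_info)
qed (auto intro: subalgebra_info trial_measurable dens_nonneg)

lemma AE_realised_iff:
  assumes "Measurable.pred (info G j \<Otimes>\<^sub>M ref G (Suc j)) (case_prod P)"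
  shows "(AE \<omega> in M. P \<omega> (trial G (Suc j) \<omega>)) \<longleftrightarrow>
    (AE \<omega> in M. AE x in ref G (Suc j). 0 < dens j \<omega> x \<longrightarrow> P \<omega> x)"
  by (rule disintegration.AE_graph_iff[OF disintegration_step assms])

lemma wt_dens_integral:
  "AE \<omega> in M. integrable (ref G (Suc j)) (\<lambda>x. wt j \<omega> x * dens j \<omega> x)"
  "AE \<omega> in M. real_cond_exp M (info G j) (\<lambda>\<omega>. wt j \<omega> (trial G (Suc j) \<omega>)) \<omega>
     = (LINT x|ref G (Suc j). wt j \<omega> x * dens j \<omega> x)"
  using disintegration.cond_exp_graph[OF disintegration_step step_joint[OF wgt_measurable] wgt_integrable]
  by auto

text \<open>
  Stated for an arbitrary fraction \<open>d\<close>, so that it covers both the fractions of a given strategy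
  and the functions of the string that define a proportional one.
\<close>

lemma cond_exp_log_return:
  assumes d: "d \<in> borel_measurable (info G j)"
    and int: "integrable M (\<lambda>\<omega>. wt j \<omega> (trial G (Suc j) \<omega>) *
      ln (1 + d \<omega> * rt j \<omega> (trial G (Suc j) \<omega>)))"
  shows "AE \<omega> in M. integrable (ref G (Suc j)) (\<lambda>x. wt j \<omega> x * dens j \<omega> x * ln (1 + d \<omega> * rt j \<omega> x))"
    and "AE \<omega> in M. real_cond_exp M (info G j) (\<lambda>\<omega>. wt j \<omega> (trial G (Suc j) \<omega>) *
      ln (1 + d \<omega> * rt j \<omega> (trial G (Suc j) \<omega>))) \<omega> = growth G j (past G j \<omega>) (d \<omega>)"
proof -
  note [measurable] = d joint_measurable
  let ?u = "\<lambda>\<omega> x. wt j \<omega> x * ln (1 + d \<omega> * rt j \<omega> x)"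
  have "case_prod ?u \<in> borel_measurable (info G j \<Otimes>\<^sub>M ref G (Suc j))"
    by measurable
  note * = disintegration.cond_exp_graph[OF disintegration_step this int]
  have eq: "?u \<omega> x * dens j \<omega> x = wt j \<omega> x * dens j \<omega> x * ln (1 + d \<omega> * rt j \<omega> x)" for \<omega> x
    by (simp add: mult_ac)
  show "AE \<omega> in M. integrable (ref G (Suc j)) (\<lambda>x. wt j \<omega> x * dens j \<omega> x * ln (1 + d \<omega> * rt j \<omega> x))"
    using *(1) unfolding eq .
  show "AE \<omega> in M. real_cond_exp M (info G j) (\<lambda>\<omega>. wt j \<omega> (trial G (Suc j) \<omega>) *
      ln (1 + d \<omega> * rt j \<omega> (trial G (Suc j) \<omega>))) \<omega> = growth G j (past G j \<omega>) (d \<omega>)"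
    using *(2) unfolding eq growth_def .
qed

section \<open>Strategies\<close>

lemma capital_info:
  assumes "cond_a0 G C"
  shows "capital G C n \<in> borel_measurable (info G n)"
proof (induction n)
  case 0
  have "capital G C 0 = capital0 G" by (rule ext) simp
  then show ?case using capital0_info[of 0] by simp
next
  case (Suc n)
  have [measurable]: "C n \<in> borel_measurable (info G (Suc n))"
    using assms by (auto simp: cond_a0_def intro: measurable_info_mono[of n "Suc n"])
  have [measurable]: "capital G C n \<in> borel_measurable (info G (Suc n))"
    by (rule measurable_info_mono[OF _ Suc]) simp
  note [measurable] = step_realised[OF ret_measurable, of n]
  have "capital G C (Suc n) = (\<lambda>\<omega>. capital G C n \<omega> + C n \<omega> * rt n \<omega> (trial G (Suc n) \<omega>))"
    by (rule ext) simp
  then show ?case by simp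
qed

lemma fraction_info:
  assumes "cond_a0 G C"
  shows "fraction G C j \<in> borel_measurable (info G j)"
  unfolding fraction_def[abs_def] using capital_info[OF assms, of j] assms
  by (intro borel_measurable_divide) (auto simp: cond_a0_def)

lemma S_sum_info:
  assumes "cond_a0 G C"
  shows "S_sum G C n \<in> borel_measurable (info G n)"
  unfolding S_sum_def[abs_def]
proof (intro borel_measurable_sum)
  fix j assume "j \<in> {..<n}"
  then have j: "Suc j \<le> n" "j \<le> n" by auto
  note [measurable] = measurable_info_mono[OF j(1) step_realised[OF wgt_measurable]]
    measurable_info_mono[OF j(1) capital_info[OF assms]]
    measurable_info_mono[OF j(2) capital_info[OF assms]]
  show "(\<lambda>\<omega>. wt j \<omega> (trial G (Suc j) \<omega>) * ln (capital G C (Suc j) \<omega> / capital G C j \<omega>))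
      \<in> borel_measurable (info G n)"
    by measurable
qed

lemma alpha_info:
  assumes "step_measurable G q"
  shows "alpha G q j \<in> borel_measurable (info G j)"
proof -
  interpret N: sigma_finite_measure "ref G (Suc j)" by (rule ref_sigma_finite)
  note [measurable] = joint_measurable step_joint[OF assms]
  show ?thesis
    unfolding alpha_def[abs_def] alpha_integrand_def
    by (rule N.borel_measurable_lebesgue_integral) measurable
qed

lemma A_sum_info:
  assumes "step_measurable G q"
  shows "A_sum G q n \<in> borel_measurable (info G n)"
  unfolding A_sum_def[abs_def]
  by (rule borel_measurable_sum) (auto intro: measurable_info_mono[OF _ alpha_info[OF assms]])

lemma stake_bounds: "cond_a1 G C \<Longrightarrow> AE \<omega> in M. 0 \<le> C j \<omega> \<and> C j \<omega> < capital G C j \<omega>"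
  by (simp add: cond_a1_def)

lemma capital_pos: "cond_a1 G C \<Longrightarrow> AE \<omega> in M. 0 < capital G C j \<omega>"
  by (erule eventually_mono[OF stake_bounds[of C j]]) linarith

lemma fraction_bounds: "cond_a1 G C \<Longrightarrow> AE \<omega> in M. 0 \<le> fraction G C j \<omega> \<and> fraction G C j \<omega> < 1"
  by (erule eventually_mono[OF stake_bounds[of C j]]) (auto simp: fraction_def)

lemma fraction_floor:
  assumes "cond_a0 G C" "cond_a2 G C"
  shows "AE \<omega> in M. AE x in ref G (Suc j). 0 < dens j \<omega> x \<longrightarrow> flr G \<le> 1 + fraction G C j \<omega> * rt j \<omega> x"
proof -
  note [measurable] = joint_measurable fraction_info[OF assms(1)]
  have "Measurable.pred (info G j \<Otimes>\<^sub>M ref G (Suc j)) (\<lambda>(\<omega>, x). flr G \<le> 1 + fraction G C j \<omega> * rt j \<omega> x)"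
    by measurable
  moreover have "AE \<omega> in M. flr G \<le> 1 + fraction G C j \<omega> * rt j \<omega> (trial G (Suc j) \<omega>)"
    using assms(2) by (simp add: cond_a2_def fraction_def)
  ultimately show ?thesis
    by (subst AE_realised_iff[symmetric]) auto
qed

text \<open>
  The strict bound of the stake by the capital makes the capital positive, so that the ratio of
  successive capitals depends on the strategy through the staked fraction only.
\<close>

lemma log_return_eq:
  assumes "cond_a1 G C"
  shows "AE \<omega> in M. S_sum G C (Suc j) \<omega> - S_sum G C j \<omega> = wt j \<omega> (trial G (Suc j) \<omega>) *
    ln (1 + fraction G C j \<omega> * rt j \<omega> (trial G (Suc j) \<omega>))"
  using capital_pos[OF assms, of j]
proof eventually_elim
  case (elim \<omega>)
  then have "capital G C (Suc j) \<omega> / capital G C j \<omega> = 1 + fraction G C j \<omega> * rt j \<omega> (trial G (Suc j) \<omega>)"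
    by (simp add: fraction_def field_simps)
  then show ?case by (simp add: S_sum_def del: capital.simps)
qed

lemma strategy_growth:
  assumes a0: "cond_a0 G C" and a1: "cond_a1 G C" and S: "S_converges G C"
  shows "AE \<omega> in M. integrable (ref G (Suc j))
      (\<lambda>x. wt j \<omega> x * dens j \<omega> x * ln (1 + fraction G C j \<omega> * rt j \<omega> x))"
    and "AE \<omega> in M. real_cond_exp M (info G j) (\<lambda>\<omega>. S_sum G C (Suc j) \<omega> - S_sum G C j \<omega>) \<omega>
      = growth G j (past G j \<omega>) (fraction G C j \<omega>)"
proof -
  interpret step: disintegration M "ref G (Suc j)" "info G j" "trial G (Suc j)" "dens j"
    by (rule disintegration_step)
  let ?s = "\<lambda>\<omega>. S_sum G C (Suc j) \<omega> - S_sum G C j \<omega>"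
  let ?l = "\<lambda>\<omega>. wt j \<omega> (trial G (Suc j) \<omega>) * ln (1 + fraction G C j \<omega> * rt j \<omega> (trial G (Suc j) \<omega>))"
  have int_s: "integrable M ?s"
    using S by (auto simp: S_converges_def)
  have [measurable]: "?s \<in> borel_measurable M"
    using int_s by (rule borel_measurable_integrable)
  note [measurable] = measurable_info_M[OF step_realised[OF wgt_measurable]]
    measurable_info_M[OF step_realised[OF ret_measurable]] measurable_info_M[OF fraction_info[OF a0]]
  have [measurable]: "?l \<in> borel_measurable M" by measurable
  have int_l: "integrable M ?l"
    using int_s log_return_eq[OF a1, of j] by (subst integrable_cong_AE[where g="?s"]) auto
  note * = cond_exp_log_return[OF fraction_info[OF a0] int_l]
  show "AE \<omega> in M. integrable (ref G (Suc j))
      (\<lambda>x. wt j \<omega> x * dens j \<omega> x * ln (1 + fraction G C j \<omega> * rt j \<omega> x))"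
    by (rule *(1))
  have "AE \<omega> in M. real_cond_exp M (info G j) ?s \<omega> = real_cond_exp M (info G j) ?l \<omega>"
    by (rule step.real_cond_exp_cong[OF log_return_eq[OF a1]]) measurable
  then show "AE \<omega> in M. real_cond_exp M (info G j) ?s \<omega> = growth G j (past G j \<omega>) (fraction G C j \<omega>)"
    using *(2) by eventually_elim simp
qed

text \<open>
  The one-step inequality. With \<open>r = 1 + d g\<close>, the bound \<open>\<integral> w q r - \<integral> w f\<close> of
  \<open>log_growth_bound\<close> splits into \<open>\<integral> w q - \<integral> w f\<close>, which is at most 0 by \<open>cond_qf\<close>, and
  \<open>d \<integral> w q g\<close>, which is 0 by \<open>cond_a3\<close>. The sign conditions on \<open>q\<close> are
  almost everywhere statements, so that \<open>q = f / (1 + D g)\<close> satisfies them.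
\<close>

lemma growth_le_alpha:
  assumes a0: "cond_a0 G C" and a1: "cond_a1 G C" and a2: "cond_a2 G C"
    and a3: "cond_a3 G q C" and S: "S_converges G C" and qf: "cond_qf G q"
    and alpha_int: "AE \<omega> in M. integrable (ref G (Suc j)) (alpha_integrand G q j (past G j \<omega>))"
    and q_pos: "AE \<omega> in M. AE x in ref G (Suc j). 0 < dens j \<omega> x \<longrightarrow> 0 < q (Suc j) (past G j \<omega>) x"
    and null: "AE \<omega> in M. AE x in ref G (Suc j). dens j \<omega> x = 0 \<longrightarrow>
      0 \<le> wt j \<omega> x * q (Suc j) (past G j \<omega>) x * (1 + fraction G C j \<omega> * rt j \<omega> x)"
  shows "AE \<omega> in M. growth G j (past G j \<omega>) (fraction G C j \<omega>) \<le> alpha G q j \<omega>"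
    and "AE \<omega> in M. growth G j (past G j \<omega>) (fraction G C j \<omega>) = alpha G q j \<omega> \<longrightarrow>
      (AE x in ref G (Suc j).
        (0 < wt j \<omega> x * dens j \<omega> x \<longrightarrow>
          q (Suc j) (past G j \<omega>) x * (1 + fraction G C j \<omega> * rt j \<omega> x) = dens j \<omega> x) \<and>
        (dens j \<omega> x = 0 \<longrightarrow>
          wt j \<omega> x * q (Suc j) (past G j \<omega>) x * (1 + fraction G C j \<omega> * rt j \<omega> x) = 0))"
proof -
  let ?N = "ref G (Suc j)"
  let ?q = "\<lambda>\<omega>. q (Suc j) (past G j \<omega>)" and ?r = "\<lambda>\<omega> x. 1 + fraction G C j \<omega> * rt j \<omega> x"
  have a3': "AE \<omega> in M. integrable ?N (\<lambda>x. wt j \<omega> x * ?q \<omega> x * rt j \<omega> x) \<and>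
      C j \<omega> * (LINT x|?N. wt j \<omega> x * ?q \<omega> x * rt j \<omega> x) = 0"
    using a3 by (simp add: cond_a3_def)
  have qf': "AE \<omega> in M. integrable ?N (\<lambda>x. wt j \<omega> x * ?q \<omega> x) \<and>
      (LINT x|?N. wt j \<omega> x * ?q \<omega> x) \<le> real_cond_exp M (info G j) (\<lambda>\<omega>'. wt j \<omega>' (trial G (Suc j) \<omega>')) \<omega>"
    using qf by (simp add: cond_qf_def)
  have main: "AE \<omega> in M. growth G j (past G j \<omega>) (fraction G C j \<omega>) \<le> alpha G q j \<omega> \<and>
      (growth G j (past G j \<omega>) (fraction G C j \<omega>) = alpha G q j \<omega> \<longrightarrow>
      (AE x in ?N. (0 < wt j \<omega> x * dens j \<omega> x \<longrightarrow> ?q \<omega> x * ?r \<omega> x = dens j \<omega> x) \<and>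
        (dens j \<omega> x = 0 \<longrightarrow> wt j \<omega> x * ?q \<omega> x * ?r \<omega> x = 0)))"
    using a3' qf' wt_dens_integral[of j] alpha_int q_pos null
      strategy_growth(1)[OF a0 a1 S, of j] fraction_floor[OF a0 a2, of j] AE_space
  proof eventually_elim
    case (elim \<omega>)
    have split: "wt j \<omega> x * ?q \<omega> x * ?r \<omega> x =
        wt j \<omega> x * ?q \<omega> x + fraction G C j \<omega> * (wt j \<omega> x * ?q \<omega> x * rt j \<omega> x)" for x
      by (simp add: algebra_simps)
    have int_qr: "integrable ?N (\<lambda>x. wt j \<omega> x * ?q \<omega> x * ?r \<omega> x)"
      unfolding split using elim by simp
    have "(LINT x|?N. wt j \<omega> x * ?q \<omega> x * ?r \<omega> x) = (LINT x|?N. wt j \<omega> x * ?q \<omega> x) +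
        fraction G C j \<omega> * (LINT x|?N. wt j \<omega> x * ?q \<omega> x * rt j \<omega> x)"
      unfolding split using elim by simp
    also have "fraction G C j \<omega> * (LINT x|?N. wt j \<omega> x * ?q \<omega> x * rt j \<omega> x) = 0"
      using elim by (auto simp: fraction_def)
    finally have budget: "(LINT x|?N. wt j \<omega> x * ?q \<omega> x * ?r \<omega> x) \<le> (LINT x|?N. wt j \<omega> x * dens j \<omega> x)"
      using elim by simp
    have W: "AE x in ?N. 0 \<le> wt j \<omega> x" and F: "AE x in ?N. 0 \<le> dens j \<omega> x"
      using elim by (auto intro!: AE_I2 wt_nonneg dens_nonneg)
    have P: "AE x in ?N. 0 < dens j \<omega> x \<longrightarrow> 0 < ?q \<omega> x \<and> 0 < ?r \<omega> x"
      using elim(6,9) by eventually_elim (use flr_pos in auto)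
    have A: "integrable ?N (\<lambda>x. wt j \<omega> x * dens j \<omega> x * ln (dens j \<omega> x / ?q \<omega> x))"
      "alpha G q j \<omega> = (LINT x|?N. wt j \<omega> x * dens j \<omega> x * ln (dens j \<omega> x / ?q \<omega> x))"
      using elim(5) by (simp_all add: alpha_def alpha_integrand_def[abs_def])
    note bound = log_growth_bound[where r = "?r \<omega>" and q = "?q \<omega>" and w = "wt j \<omega>" and f = "dens j \<omega>",
        OF W F P elim(7) elim(3) int_qr elim(8) A(1), folded A(2) growth_def]
    show ?case
      using bound budget by auto
  qed
  from main show "AE \<omega> in M. growth G j (past G j \<omega>) (fraction G C j \<omega>) \<le> alpha G q j \<omega>"
    by eventually_elim simp
  from main show "AE \<omega> in M. growth G j (past G j \<omega>) (fraction G C j \<omega>) = alpha G q j \<omega> \<longrightarrow>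
      (AE x in ?N. (0 < wt j \<omega> x * dens j \<omega> x \<longrightarrow> ?q \<omega> x * ?r \<omega> x = dens j \<omega> x) \<and>
        (dens j \<omega> x = 0 \<longrightarrow> wt j \<omega> x * ?q \<omega> x * ?r \<omega> x = 0))"
    by eventually_elim simp
qed

section \<open>Drift of S - A\<close>

definition excess where
  "excess q C n \<omega> = S_sum G C n \<omega> - A_sum G q n \<omega>"

lemma A_sum_integrable:
  assumes "alpha_converges G q"
  shows "integrable M (A_sum G q n)"
  using assms unfolding A_sum_def[abs_def] alpha_converges_def by auto

lemma excess_adapted:
  assumes "cond_a0 G C" "S_converges G C" "step_measurable G q" "alpha_converges G q"
  shows "adapted_integrable M (info G) (excess q C)"
  unfolding adapted_integrable_def
proof (intro conjI allI filtration_info subalgebra_info)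
  fix n
  show "excess q C n \<in> borel_measurable (info G n)"
    unfolding excess_def[abs_def] using S_sum_info[OF assms(1)] A_sum_info[OF assms(3)]
    by (rule borel_measurable_diff)
  show "integrable M (excess q C n)"
    unfolding excess_def[abs_def] using assms(2) A_sum_integrable[OF assms(4)]
    by (auto simp: S_converges_def)
qed

lemma excess_drift:
  assumes "cond_a0 G C" "cond_a1 G C" "S_converges G C" "step_measurable G q" "alpha_converges G q"
  shows "AE \<omega> in M. real_cond_exp M (info G n) (\<lambda>\<omega>. excess q C (Suc n) \<omega> - excess q C n \<omega>) \<omega>
    = growth G n (past G n \<omega>) (fraction G C n \<omega>) - alpha G q n \<omega>"
proof -
  interpret step: disintegration M "ref G (Suc n)" "info G n" "trial G (Suc n)" "dens n"
    by (rule disintegration_step)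
  have eq: "excess q C (Suc n) \<omega> - excess q C n \<omega> = (S_sum G C (Suc n) \<omega> - S_sum G C n \<omega>) - alpha G q n \<omega>" for \<omega>
    by (simp add: excess_def A_sum_def)
  have a: "integrable M (alpha G q n)"
    using assms(5) by (simp add: alpha_converges_def)
  have "AE \<omega> in M. real_cond_exp M (info G n) (\<lambda>\<omega>. (S_sum G C (Suc n) \<omega> - S_sum G C n \<omega>) - alpha G q n \<omega>) \<omega>
      = real_cond_exp M (info G n) (\<lambda>\<omega>. S_sum G C (Suc n) \<omega> - S_sum G C n \<omega>) \<omega>
        - real_cond_exp M (info G n) (alpha G q n) \<omega>"
    using assms(3) a by (intro step.real_cond_exp_diff) (auto simp: S_converges_def)
  moreover have "AE \<omega> in M. real_cond_exp M (info G n) (alpha G q n) \<omega> = alpha G q n \<omega>"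
    by (rule step.real_cond_exp_F_meas[OF a alpha_info[OF assms(4)]])
  ultimately show ?thesis
    unfolding eq using strategy_growth(2)[OF assms(1-3), of n] by eventually_elim simp
qed

lemma martingale_iff_growth:
  assumes "cond_a0 G C" "cond_a1 G C" "S_converges G C" "step_measurable G q" "alpha_converges G q"
  shows "martingale M (info G) (excess q C) \<longleftrightarrow>
    (\<forall>j. AE \<omega> in M. growth G j (past G j \<omega>) (fraction G C j \<omega>) = alpha G q j \<omega>)"
proof -
  have "(AE \<omega> in M. real_cond_exp M (info G n) (\<lambda>\<omega>. excess q C (Suc n) \<omega> - excess q C n \<omega>) \<omega> = 0) \<longleftrightarrow>
      (AE \<omega> in M. growth G n (past G n \<omega>) (fraction G C n \<omega>) = alpha G q n \<omega>)" for n
    using excess_drift[OF assms, of n] by (auto elim: eventually_elim2)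
  then show ?thesis
    using martingale_increments[OF excess_adapted[OF assms(1,3,4,5)]] by simp
qed

lemma excess_0: "excess q C 0 \<omega> = 0"
  by (simp add: excess_def S_sum_def A_sum_def)

lemma excess_integral:
  assumes "adapted_integrable M (info G) (excess q C)"
  shows "(LINT \<omega>|M. real_cond_exp M (info G 0) (excess q C n) \<omega>) = (LINT \<omega>|M. excess q C n \<omega>)"
    and "integrable M (real_cond_exp M (info G 0) (excess q C n))"
proof -
  interpret step: disintegration M "ref G (Suc 0)" "info G 0" "trial G (Suc 0)" "dens 0"
    by (rule disintegration_step)
  have "integrable M (excess q C n)" using assms by (simp add: adapted_integrable_def)
  then show "(LINT \<omega>|M. real_cond_exp M (info G 0) (excess q C n) \<omega>) = (LINT \<omega>|M. excess q C n \<omega>)"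
    and "integrable M (real_cond_exp M (info G 0) (excess q C n))"
    by (simp_all add: step.real_cond_exp_int)
qed

lemma excess_integral_eq:
  assumes "S_converges G C" "alpha_converges G q"
  shows "(LINT \<omega>|M. excess q C n \<omega>) = (LINT \<omega>|M. S_sum G C n \<omega>) - (LINT \<omega>|M. A_sum G q n \<omega>)"
  unfolding excess_def using assms A_sum_integrable
  by (intro Bochner_Integration.integral_diff) (auto simp: S_converges_def)

lemma supermartingale_mean:
  assumes "supermartingale M (info G) (excess q C)" "S_converges G C" "alpha_converges G q"
  shows "(LINT \<omega>|M. S_sum G C n \<omega>) \<le> (LINT \<omega>|M. A_sum G q n \<omega>)"
proof -
  have ad: "adapted_integrable M (info G) (excess q C)"
    using assms by (simp add: supermartingale_def)
  have "AE \<omega> in M. real_cond_exp M (info G 0) (excess q C n) \<omega> \<le> excess q C 0 \<omega>"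
    using assms(1) by (simp add: supermartingale_def)
  then have "(LINT \<omega>|M. real_cond_exp M (info G 0) (excess q C n) \<omega>) \<le> (LINT \<omega>|M. 0)"
    using excess_integral(2)[OF ad] by (intro integral_mono_AE) (auto simp: excess_0)
  then show ?thesis
    using excess_integral(1)[OF ad] excess_integral_eq[OF assms(2,3)] by simp
qed

lemma martingale_mean:
  assumes "martingale M (info G) (excess q C)" "S_converges G C" "alpha_converges G q"
  shows "(LINT \<omega>|M. S_sum G C n \<omega>) = (LINT \<omega>|M. A_sum G q n \<omega>)"
proof -
  have ad: "adapted_integrable M (info G) (excess q C)"
    using assms by (simp add: martingale_def)
  have "AE \<omega> in M. real_cond_exp M (info G 0) (excess q C n) \<omega> = excess q C 0 \<omega>"
    using assms(1) by (simp add: martingale_def)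
  then have "(LINT \<omega>|M. real_cond_exp M (info G 0) (excess q C n) \<omega>) = (LINT \<omega>|M. 0)"
    using excess_integral(2)[OF ad] by (intro integral_cong_AE) (auto simp: excess_0)
  then show ?thesis
    using excess_integral(1)[OF ad] excess_integral_eq[OF assms(2,3)] by simp
qed

lemma calibrating_pos:
  assumes "calibrating G q"
  shows "AE \<omega> in M. AE x in ref G (Suc j). 0 < dens j \<omega> x \<longrightarrow> 0 < q (Suc j) (past G j \<omega>) x"
proof -
  have q: "step_measurable G q" using assms by (simp add: calibrating_def)
  have "Measurable.pred (info G j \<Otimes>\<^sub>M ref G (Suc j)) (\<lambda>(\<omega>, x). 0 < q (Suc j) (past G j \<omega>) x)"
    using step_joint[OF q, of j] by measurable
  then show ?thesis
    using assms by (subst AE_realised_iff[symmetric]) (auto simp: calibrating_def)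
qed

text \<open>
  At outcomes of density 0 the bound on the stake comes from \<open>cond_a2_null\<close>; it keeps the
  integrand \<open>w q (1 + d g)\<close> nonnegative there.
\<close>

lemma calibrating_null:
  assumes "calibrating G q" "cond_a2_null G q C"
  shows "AE \<omega> in M. AE x in ref G (Suc j). dens j \<omega> x = 0 \<longrightarrow>
    0 \<le> wt j \<omega> x * q (Suc j) (past G j \<omega>) x \<and>
    (0 < wt j \<omega> x * q (Suc j) (past G j \<omega>) x \<longrightarrow> 0 < 1 + fraction G C j \<omega> * rt j \<omega> x)"
proof -
  have q0: "step_nonneg G q" using assms by (simp add: calibrating_def)
  have "AE \<omega> in M. AE x in ref G (Suc j). dens j \<omega> x = 0 \<and>
      0 < wt j \<omega> x * q (Suc j) (past G j \<omega>) x \<longrightarrow> flr G \<le> 1 + C j \<omega> * rt j \<omega> x / capital G C j \<omega>"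
    using assms(2) by (simp add: cond_a2_null_def)
  then show ?thesis
    using AE_space
  proof eventually_elim
    case (elim \<omega>)
    show ?case
      using elim(1) AE_space
    proof eventually_elim
      case (elim x)
      have "0 \<le> wt j \<omega> x * q (Suc j) (past G j \<omega>) x"
        using step_nonneg_at[OF q0] wt_nonneg elim(2) \<open>\<omega> \<in> space M\<close> by simp
      then show ?case
        using elim(1) flr_pos by (auto simp: fraction_def)
    qed
  qed
qed

lemma growth_le_alpha_calibrating:
  assumes "calibrating G q" "cond_qf G q" "alpha_converges G q"
    and "cond_a0 G C" "cond_a1 G C" "cond_a2 G C" "cond_a2_null G q C" "cond_a3 G q C" "S_converges G C"
  shows "AE \<omega> in M. growth G j (past G j \<omega>) (fraction G C j \<omega>) \<le> alpha G q j \<omega>"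
    and "AE \<omega> in M. growth G j (past G j \<omega>) (fraction G C j \<omega>) = alpha G q j \<omega> \<longrightarrow>
      (AE x in ref G (Suc j).
        (0 < wt j \<omega> x * dens j \<omega> x \<longrightarrow>
          q (Suc j) (past G j \<omega>) x * (1 + fraction G C j \<omega> * rt j \<omega> x) = dens j \<omega> x) \<and>
        (dens j \<omega> x = 0 \<longrightarrow>
          wt j \<omega> x * q (Suc j) (past G j \<omega>) x * (1 + fraction G C j \<omega> * rt j \<omega> x) = 0))"
proof -
  have alpha_int: "AE \<omega> in M. integrable (ref G (Suc j)) (alpha_integrand G q j (past G j \<omega>))"
    using assms(3) by (simp add: alpha_converges_def)
  have null: "AE \<omega> in M. AE x in ref G (Suc j). dens j \<omega> x = 0 \<longrightarrow>
      0 \<le> wt j \<omega> x * q (Suc j) (past G j \<omega>) x * (1 + fraction G C j \<omega> * rt j \<omega> x)"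
    using calibrating_null[OF assms(1,7), of j]
  proof eventually_elim
    case (elim \<omega>)
    then show ?case
    proof eventually_elim
      case (elim x)
      then show ?case
        by (cases "wt j \<omega> x * q (Suc j) (past G j \<omega>) x = 0") auto
    qed
  qed
  note * = growth_le_alpha[OF assms(4-6,8,9,2) alpha_int calibrating_pos[OF assms(1)] null]
  show "AE \<omega> in M. growth G j (past G j \<omega>) (fraction G C j \<omega>) \<le> alpha G q j \<omega>"
    by (rule *(1))
  show "AE \<omega> in M. growth G j (past G j \<omega>) (fraction G C j \<omega>) = alpha G q j \<omega> \<longrightarrow>
      (AE x in ref G (Suc j).
        (0 < wt j \<omega> x * dens j \<omega> x \<longrightarrow>
          q (Suc j) (past G j \<omega>) x * (1 + fraction G C j \<omega> * rt j \<omega> x) = dens j \<omega> x) \<and>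
        (dens j \<omega> x = 0 \<longrightarrow>
          wt j \<omega> x * q (Suc j) (past G j \<omega>) x * (1 + fraction G C j \<omega> * rt j \<omega> x) = 0))"
    by (rule *(2))
qed

lemma excess_supermartingale:
  assumes "calibrating G q" "cond_qf G q" "alpha_converges G q"
    and "cond_a0 G C" "cond_a1 G C" "cond_a2 G C" "cond_a2_null G q C" "cond_a3 G q C" "S_converges G C"
  shows "supermartingale M (info G) (excess q C)"
proof (rule supermartingale_increments)
  have q: "step_measurable G q" using assms(1) by (simp add: calibrating_def)
  show "adapted_integrable M (info G) (excess q C)"
    by (rule excess_adapted[OF assms(4,9) q assms(3)])
  show "AE \<omega> in M. real_cond_exp M (info G n) (\<lambda>\<omega>. excess q C (Suc n) \<omega> - excess q C n \<omega>) \<omega> \<le> 0" for n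
    using excess_drift[OF assms(4,5,9) q assms(3), of n] growth_le_alpha_calibrating(1)[OF assms, of n]
    by eventually_elim simp
qed

section \<open>The case of equality\<close>

lemma string_function_info:
  assumes "string_functions G D"
  shows "(\<lambda>\<omega>. D j (past G j \<omega>)) \<in> borel_measurable (info G j)"
  using assms measurable_compose[OF past_info[of j j], of "D j" borel] by (simp add: string_functions_def)

lemma string_fraction_floor:
  assumes "string_functions G D" "cond_i2 G D"
  shows "AE \<omega> in M. AE x in ref G (Suc j). 0 < dens j \<omega> x \<longrightarrow> flr G \<le> 1 + D j (past G j \<omega>) * rt j \<omega> x"
proof -
  note [measurable] = joint_measurable string_function_info[OF assms(1)]
  have "Measurable.pred (info G j \<Otimes>\<^sub>M ref G (Suc j)) (\<lambda>(\<omega>, x). flr G \<le> 1 + D j (past G j \<omega>) * rt j \<omega> x)"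
    by measurable
  then show ?thesis
    using assms(2) by (subst AE_realised_iff[symmetric]) (auto simp: cond_i2_def)
qed

lemma fraction_proportional:
  assumes "cond_a1 G C"
  shows "cond_ii G D C \<longleftrightarrow> (\<forall>j. AE \<omega> in M. fraction G C j \<omega> = D j (past G j \<omega>))"
proof -
  have "(AE \<omega> in M. C j \<omega> = D j (past G j \<omega>) * capital G C j \<omega>) \<longleftrightarrow>
      (AE \<omega> in M. fraction G C j \<omega> = D j (past G j \<omega>))" for j
    using capital_pos[OF assms, of j]
    by (auto elim!: eventually_elim2 simp: fraction_def field_simps)
  then show ?thesis by (simp add: cond_ii_def)
qed

lemma cond_i4_density:
  assumes "step_measurable G q" "string_functions G D"
  shows "cond_i4 G q D \<longleftrightarrow> (\<forall>j. AE \<omega> in M. AE x in ref G (Suc j). 0 < dens j \<omega> x \<longrightarrow>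
    0 < wt j \<omega> x \<longrightarrow> q (Suc j) (past G j \<omega>) x = dens j \<omega> x / (1 + D j (past G j \<omega>) * rt j \<omega> x))"
proof -
  have "(AE \<omega> in M. 0 < wt j \<omega> (trial G (Suc j) \<omega>) \<longrightarrow> q (Suc j) (past G j \<omega>) (trial G (Suc j) \<omega>) =
      dens j \<omega> (trial G (Suc j) \<omega>) / (1 + D j (past G j \<omega>) * rt j \<omega> (trial G (Suc j) \<omega>))) \<longleftrightarrow>
    (AE \<omega> in M. AE x in ref G (Suc j). 0 < dens j \<omega> x \<longrightarrow>
    0 < wt j \<omega> x \<longrightarrow> q (Suc j) (past G j \<omega>) x = dens j \<omega> x / (1 + D j (past G j \<omega>) * rt j \<omega> x))" for j
  proof (rule AE_realised_iff)
    note [measurable] = joint_measurable string_function_info[OF assms(2)] step_joint[OF assms(1)]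
    show "Measurable.pred (info G j \<Otimes>\<^sub>M ref G (Suc j)) (\<lambda>(\<omega>, x). 0 < wt j \<omega> x \<longrightarrow>
        q (Suc j) (past G j \<omega>) x = dens j \<omega> x / (1 + D j (past G j \<omega>) * rt j \<omega> x))"
      by measurable
  qed
  then show ?thesis by (simp add: cond_i4_def calib_of_def)
qed

text \<open>
  Where \<open>\<phi> f > 0\<close>, the formula for \<open>q\<close> says \<open>f / q = 1 + d g\<close>, so the integrands defining the
  growth and \<open>\<alpha>\<close> coincide; elsewhere both are 0.
\<close>

lemma proportional_growth:
  assumes q: "step_measurable G q" and D: "string_functions G D" "cond_i2 G D"
    and i4: "cond_i4 G q D" and ii: "cond_ii G D C" and a1: "cond_a1 G C"
  shows "AE \<omega> in M. growth G j (past G j \<omega>) (fraction G C j \<omega>) = alpha G q j \<omega>"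
proof -
  have ii': "AE \<omega> in M. fraction G C j \<omega> = D j (past G j \<omega>)"
    using ii fraction_proportional[OF a1] by blast
  have i4': "AE \<omega> in M. AE x in ref G (Suc j). 0 < dens j \<omega> x \<longrightarrow> 0 < wt j \<omega> x \<longrightarrow>
      q (Suc j) (past G j \<omega>) x = dens j \<omega> x / (1 + D j (past G j \<omega>) * rt j \<omega> x)"
    using i4 cond_i4_density[OF q D(1)] by blast
  show ?thesis
    using ii' i4' string_fraction_floor[OF D, of j] AE_space
  proof eventually_elim
    case (elim \<omega>)
    note [measurable] = section_measurable[OF elim(4)] step_section[OF q elim(4)]
    have "AE x in ref G (Suc j). wt j \<omega> x * dens j \<omega> x * ln (1 + fraction G C j \<omega> * rt j \<omega> x)
        = alpha_integrand G q j (past G j \<omega>) x"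
      using elim(2,3) AE_space
    proof eventually_elim
      case (elim x)
      have nn: "0 \<le> dens j \<omega> x" "0 \<le> wt j \<omega> x"
        using dens_nonneg wt_nonneg elim(3) \<open>\<omega> \<in> space M\<close> by auto
      show ?case
      proof (cases "0 < dens j \<omega> x \<and> 0 < wt j \<omega> x")
        case True
        then have "0 < 1 + D j (past G j \<omega>) * rt j \<omega> x"
          using elim(2) flr_pos by simp
        then have "dens j \<omega> x / q (Suc j) (past G j \<omega>) x = 1 + fraction G C j \<omega> * rt j \<omega> x"
          using True elim(1) \<open>fraction G C j \<omega> = D j (past G j \<omega>)\<close> by simp
        then show ?thesis by (simp add: alpha_integrand_def)
      qed (use nn in \<open>auto simp: alpha_integrand_def not_less\<close>)
    qed
    then show ?case
      unfolding growth_def alpha_def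
      by (intro integral_cong_AE) (auto simp: alpha_integrand_def[abs_def])
  qed
qed

text \<open>
  The solution \<open>d\<close> of \<open>q (1 + d g) = f\<close>, averaged over the set where \<open>\<phi> f g \<noteq> 0\<close> with weight
  \<open>f\<close>. There \<open>d = (f / q - 1) / g\<close> does not depend on \<open>x\<close>, so averaging changes nothing, but it
  yields a measurable function of the string.
\<close>

definition implied_fraction ::
  "(nat \<Rightarrow> (nat \<Rightarrow> 'x) \<Rightarrow> 'x \<Rightarrow> real) \<Rightarrow> nat \<Rightarrow> (nat \<Rightarrow> 'x) \<Rightarrow> real" where
  "implied_fraction q j h =
    (LINT x|ref G (Suc j). (if wgt G (Suc j) h x * cdens G (Suc j) h x * ret G (Suc j) h x = 0 then 0
       else cdens G (Suc j) h x * ((cdens G (Suc j) h x / q (Suc j) h x - 1) / ret G (Suc j) h x))) /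
    (LINT x|ref G (Suc j). (if wgt G (Suc j) h x * cdens G (Suc j) h x * ret G (Suc j) h x = 0 then 0
       else cdens G (Suc j) h x))"

lemma implied_fraction_measurable:
  assumes "step_measurable G q"
  shows "string_functions G (implied_fraction q)"
  unfolding string_functions_def
proof
  fix j
  interpret N: sigma_finite_measure "ref G (Suc j)" by (rule ref_sigma_finite)
  have [measurable]: "(\<lambda>(h, x). u (Suc j) h x) \<in> borel_measurable (strings G j \<Otimes>\<^sub>M ref G (Suc j))"
    if "step_measurable G u" for u
    using that by (simp add: step_measurable_def)
  note [measurable] = this[OF cdens_measurable] this[OF wgt_measurable] this[OF ret_measurable] this[OF assms]
  show "implied_fraction q j \<in> borel_measurable (strings G j)"
    unfolding implied_fraction_def[abs_def] by measurable
qed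

text \<open>
  The numerator of \<open>implied_fraction\<close> is \<open>d\<close> times the denominator, and the denominator is
  nonzero because the weighted return does not vanish almost everywhere. As
  \<open>implied_fraction\<close> depends on the string only, \<open>d\<close> cannot depend on the initial capital.
\<close>

lemma fraction_implied:
  assumes nd: "nondegenerate G"
    and q_pos: "AE \<omega> in M. AE x in ref G (Suc j). 0 < dens j \<omega> x \<longrightarrow> 0 < q (Suc j) (past G j \<omega>) x"
    and eq: "AE \<omega> in M. AE x in ref G (Suc j). 0 < wt j \<omega> x * dens j \<omega> x \<longrightarrow>
      q (Suc j) (past G j \<omega>) x * (1 + d \<omega> * rt j \<omega> x) = dens j \<omega> x"
    and q: "step_measurable G q"
  shows "AE \<omega> in M. d \<omega> = implied_fraction q j (past G j \<omega>)"
proof -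
  have nd': "AE \<omega> in M. \<not> (AE x in ref G (Suc j). wt j \<omega> x * dens j \<omega> x * rt j \<omega> x = 0)"
    using nd by (simp add: nondegenerate_def)
  have "AE \<omega> in M. integrable (ref G (Suc j)) (dens j \<omega>) \<and> (LINT x|ref G (Suc j). dens j \<omega> x) = 1"
    by (rule disintegration.density_integral[OF disintegration_step])
  then show ?thesis
    using nd' q_pos eq AE_space
  proof eventually_elim
    case (elim \<omega>)
    note [measurable] = section_measurable[OF elim(5)] step_section[OF q elim(5)]
    let ?N = "ref G (Suc j)"
    let ?k = "\<lambda>x. if wt j \<omega> x * dens j \<omega> x * rt j \<omega> x = 0 then 0 else dens j \<omega> x"
    have k_int: "integrable ?N ?k"
      using elim(1) by (intro Bochner_Integration.integrable_bound[of ?N "dens j \<omega>" ?k]) auto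
    have k_nonneg: "AE x in ?N. 0 \<le> ?k x"
      using elim(5) by (auto intro!: AE_I2 dens_nonneg)
    have "(LINT x|?N. (if wt j \<omega> x * dens j \<omega> x * rt j \<omega> x = 0 then 0
       else dens j \<omega> x * ((dens j \<omega> x / q (Suc j) (past G j \<omega>) x - 1) / rt j \<omega> x)))
       = (LINT x|?N. d \<omega> * ?k x)"
    proof (rule integral_cong_AE)
      show "AE x in ?N. (if wt j \<omega> x * dens j \<omega> x * rt j \<omega> x = 0 then 0
         else dens j \<omega> x * ((dens j \<omega> x / q (Suc j) (past G j \<omega>) x - 1) / rt j \<omega> x)) = d \<omega> * ?k x"
        using elim(3,4) AE_space
      proof eventually_elim
        case (elim x)
        show ?case
        proof (cases "wt j \<omega> x * dens j \<omega> x * rt j \<omega> x = 0")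
          case False
          have "0 \<le> dens j \<omega> x" "0 \<le> wt j \<omega> x"
            using dens_nonneg wt_nonneg elim(3) \<open>\<omega> \<in> space M\<close> by auto
          with False have "0 < dens j \<omega> x" "0 < wt j \<omega> x" "rt j \<omega> x \<noteq> 0" by auto
          moreover from this have "0 < q (Suc j) (past G j \<omega>) x"
            "q (Suc j) (past G j \<omega>) x * (1 + d \<omega> * rt j \<omega> x) = dens j \<omega> x"
            using elim by auto
          moreover from this have "dens j \<omega> x / q (Suc j) (past G j \<omega>) x = 1 + d \<omega> * rt j \<omega> x"
            by (simp add: field_simps)
          ultimately show ?thesis using False by simp
        qed simp
      qed
    qed measurable
    moreover have "integral\<^sup>L ?N ?k \<noteq> 0"
    proof
      assume "integral\<^sup>L ?N ?k = 0"
      then have "AE x in ?N. ?k x = 0"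
        using integral_nonneg_eq_0_iff_AE[OF k_int k_nonneg] by simp
      then have "AE x in ?N. wt j \<omega> x * dens j \<omega> x * rt j \<omega> x = 0"
        by eventually_elim (auto split: if_splits)
      with elim(2) show False by simp
    qed
    ultimately show ?case
      by (simp add: implied_fraction_def)
  qed
qed

text \<open>
  A martingale has zero drift, so the inequality of \<open>growth_le_alpha\<close> is an equality at every
  step. This determines \<open>q\<close> where \<open>\<phi> f > 0\<close> and shows that \<open>\<phi> q = 0\<close> where \<open>f = 0\<close>. Hence
  \<open>\<phi> q g\<close> is almost everywhere the integrand of \<open>cond_i3\<close>, and \<open>cond_a3\<close> turns into
  \<open>cond_i3\<close>.
\<close>

lemma martingale_proportional:
  assumes cal: "calibrating G q" and rest: "cond_qf G q" "alpha_converges G q"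
    and C: "cond_a0 G C" "cond_a1 G C" "cond_a2 G C" "cond_a2_null G q C" "cond_a3 G q C" "S_converges G C"
    and nd: "nondegenerate G" and mart: "martingale M (info G) (excess q C)"
  shows "\<exists>D. string_functions G D \<and> cond_i1 G D \<and> cond_i2 G D \<and> cond_i3 G D \<and>
    cond_i4 G q D \<and> cond_ii G D C"
proof -
  have q: "step_measurable G q" using cal by (simp add: calibrating_def)
  define D where "D = implied_fraction q"
  have sD: "string_functions G D"
    unfolding D_def by (rule implied_fraction_measurable[OF q])
  \<comment> \<open>equality in \<open>log_growth_bound\<close>\<close>
  have tight: "AE \<omega> in M. AE x in ref G (Suc j). (0 < wt j \<omega> x * dens j \<omega> x \<longrightarrow>
      q (Suc j) (past G j \<omega>) x * (1 + fraction G C j \<omega> * rt j \<omega> x) = dens j \<omega> x) \<and>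
      (dens j \<omega> x = 0 \<longrightarrow> wt j \<omega> x * q (Suc j) (past G j \<omega>) x * (1 + fraction G C j \<omega> * rt j \<omega> x) = 0)" for j
  proof -
    have "AE \<omega> in M. growth G j (past G j \<omega>) (fraction G C j \<omega>) = alpha G q j \<omega>"
      using mart martingale_iff_growth[OF C(1,2,6) q rest(2)] by blast
    then show ?thesis
      using growth_le_alpha_calibrating(2)[OF cal rest C, of j] by eventually_elim simp
  qed
  have dD: "AE \<omega> in M. fraction G C j \<omega> = D j (past G j \<omega>)" for j
    unfolding D_def
  proof (rule fraction_implied[OF nd calibrating_pos[OF cal] _ q])
    show "AE \<omega> in M. AE x in ref G (Suc j). 0 < wt j \<omega> x * dens j \<omega> x \<longrightarrow>
        q (Suc j) (past G j \<omega>) x * (1 + fraction G C j \<omega> * rt j \<omega> x) = dens j \<omega> x"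
      using tight[of j] by eventually_elim (erule eventually_mono, simp)
  qed
  have floor: "AE \<omega> in M. AE x in ref G (Suc j). 0 < dens j \<omega> x \<longrightarrow> 0 < 1 + D j (past G j \<omega>) * rt j \<omega> x" for j
    using fraction_floor[OF C(1,3), of j] dD[of j]
    by eventually_elim (erule eventually_mono, use flr_pos in auto)
  have i1: "cond_i1 G D"
    unfolding cond_i1_def
  proof
    fix j show "AE \<omega> in M. 0 \<le> D j (past G j \<omega>) \<and> D j (past G j \<omega>) < 1"
      using fraction_bounds[OF C(2), of j] dD[of j] by eventually_elim simp
  qed
  have i2: "cond_i2 G D"
    unfolding cond_i2_def
  proof
    fix j
    have "AE \<omega> in M. flr G \<le> 1 + fraction G C j \<omega> * rt j \<omega> (trial G (Suc j) \<omega>)"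
      using C(3) by (simp add: cond_a2_def fraction_def)
    then show "AE \<omega> in M. flr G \<le> 1 + D j (past G j \<omega>) * rt j \<omega> (trial G (Suc j) \<omega>)"
      using dD[of j] by eventually_elim simp
  qed
  have i4: "cond_i4 G q D"
    unfolding cond_i4_density[OF q sD]
  proof
    fix j
    show "AE \<omega> in M. AE x in ref G (Suc j). 0 < dens j \<omega> x \<longrightarrow> 0 < wt j \<omega> x \<longrightarrow>
        q (Suc j) (past G j \<omega>) x = dens j \<omega> x / (1 + D j (past G j \<omega>) * rt j \<omega> x)"
      using tight[of j] dD[of j] floor[of j]
    proof eventually_elim
      case (elim \<omega>)
      show ?case
        using elim(1,3) by eventually_elim (use elim(2) in \<open>auto simp: field_simps\<close>)
    qed
  qed
  have i3: "cond_i3 G D"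
    unfolding cond_i3_def
  proof
    fix j
    have a3: "AE \<omega> in M. integrable (ref G (Suc j)) (\<lambda>x. wt j \<omega> x * q (Suc j) (past G j \<omega>) x * rt j \<omega> x) \<and>
        C j \<omega> * (LINT x|ref G (Suc j). wt j \<omega> x * q (Suc j) (past G j \<omega>) x * rt j \<omega> x) = 0"
      using C(5) by (simp add: cond_a3_def)
    show "AE \<omega> in M. integrable (ref G (Suc j)) (i3_integrand G j (past G j \<omega>) (D j (past G j \<omega>))) \<and>
        D j (past G j \<omega>) * (LINT x|ref G (Suc j). i3_integrand G j (past G j \<omega>) (D j (past G j \<omega>)) x) = 0"
      using tight[of j] dD[of j] floor[of j] calibrating_null[OF cal C(4), of j] a3 AE_space
    proof eventually_elim
      case (elim \<omega>)
      note d = elim(2)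
      note [measurable] = section_measurable[OF elim(6)] step_section[OF q elim(6)]
      have ae: "AE x in ref G (Suc j). i3_integrand G j (past G j \<omega>) (D j (past G j \<omega>)) x
          = wt j \<omega> x * q (Suc j) (past G j \<omega>) x * rt j \<omega> x"
        using elim(1,3,4) AE_space
      proof eventually_elim
        case (elim x)
        have nn: "0 \<le> dens j \<omega> x" "0 \<le> wt j \<omega> x"
          using dens_nonneg wt_nonneg elim(4) \<open>\<omega> \<in> space M\<close> by auto
        consider "wt j \<omega> x = 0" | "dens j \<omega> x = 0" | "0 < wt j \<omega> x" "0 < dens j \<omega> x"
          using nn by linarith
        then show ?case
        proof cases
          case 1
          then show ?thesis by (simp add: i3_integrand_def)
        next
          case 2
          \<comment> \<open>if \<open>\<phi> q\<close> were positive, so would be \<open>1 + d g\<close>, contrary to \<open>\<phi> q (1 + d g) = 0\<close>\<close>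
          then have "wt j \<omega> x * q (Suc j) (past G j \<omega>) x = 0"
            using elim by auto
          then show ?thesis using 2 by (auto simp: i3_integrand_def)
        next
          case 3
          then have "0 < 1 + D j (past G j \<omega>) * rt j \<omega> x"
            "q (Suc j) (past G j \<omega>) x * (1 + D j (past G j \<omega>) * rt j \<omega> x) = dens j \<omega> x"
            using elim d by auto
          then have "dens j \<omega> x / (1 + D j (past G j \<omega>) * rt j \<omega> x) = q (Suc j) (past G j \<omega>) x"
            by (simp add: field_simps)
          then have "wt j \<omega> x * rt j \<omega> x * (dens j \<omega> x / (1 + D j (past G j \<omega>) * rt j \<omega> x))
              = wt j \<omega> x * rt j \<omega> x * q (Suc j) (past G j \<omega>) x"
            by simp
          then show ?thesis by (simp add: i3_integrand_def mult_ac)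
        qed
      qed
      have m: "i3_integrand G j (past G j \<omega>) (D j (past G j \<omega>)) \<in> borel_measurable (ref G (Suc j))"
        unfolding i3_integrand_def[abs_def] by measurable
      have "integrable (ref G (Suc j)) (i3_integrand G j (past G j \<omega>) (D j (past G j \<omega>)))"
        using elim(5) ae m by (subst integrable_cong_AE) auto
      moreover have "(LINT x|ref G (Suc j). i3_integrand G j (past G j \<omega>) (D j (past G j \<omega>)) x) =
          (LINT x|ref G (Suc j). wt j \<omega> x * q (Suc j) (past G j \<omega>) x * rt j \<omega> x)"
        using ae m by (intro integral_cong_AE) auto
      ultimately show ?case
        using elim(5) d by (auto simp: fraction_def)
    qed
  qed
  have "cond_ii G D C"
    using fraction_proportional[OF C(2)] dD by blast
  with sD i1 i2 i3 i4 show ?thesis by blast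
qed

section \<open>Calibrating functions f / (1 + D g)\<close>

text \<open>
  Integrate \<open>f / (1 + D g) = f - D f g / (1 + D g)\<close>; the left-hand side is at most \<open>f / b\<close>, hence
  integrable.
\<close>

lemma calib_of_mass:
  assumes D: "string_functions G D" "cond_i2 G D"
  shows "AE \<omega> in M. (LINT x|ref G (Suc j). calib_of G D (Suc j) (past G j \<omega>) x) =
    1 - D j (past G j \<omega>) * (LINT x|ref G (Suc j). dens j \<omega> x * rt j \<omega> x / (1 + D j (past G j \<omega>) * rt j \<omega> x))"
proof -
  have "AE \<omega> in M. integrable (ref G (Suc j)) (dens j \<omega>) \<and> (LINT x|ref G (Suc j). dens j \<omega> x) = 1"
    by (rule disintegration.density_integral[OF disintegration_step])
  then show ?thesis
    using string_fraction_floor[OF D, of j] AE_space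
  proof eventually_elim
    case (elim \<omega>)
    note [measurable] = section_measurable[OF elim(3)]
    let ?N = "ref G (Suc j)" and ?d = "D j (past G j \<omega>)"
    have ae: "AE x in ?N. \<bar>dens j \<omega> x / (1 + ?d * rt j \<omega> x)\<bar> \<le> dens j \<omega> x / flr G \<and>
        ?d * (dens j \<omega> x * rt j \<omega> x / (1 + ?d * rt j \<omega> x)) = dens j \<omega> x - dens j \<omega> x / (1 + ?d * rt j \<omega> x)"
      using elim(2) AE_space
    proof eventually_elim
      case (elim x)
      have "0 \<le> dens j \<omega> x" using dens_nonneg elim(2) \<open>\<omega> \<in> space M\<close> by auto
      then consider "dens j \<omega> x = 0" | "0 < dens j \<omega> x" by linarith
      then show ?case
      proof cases
        case 2
        then have fl: "flr G \<le> 1 + ?d * rt j \<omega> x" using elim by simp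
        have pos: "0 < 1 + ?d * rt j \<omega> x" using fl flr_pos by simp
        have "dens j \<omega> x / (1 + ?d * rt j \<omega> x) \<le> dens j \<omega> x / flr G"
          using fl 2 flr_pos by (intro divide_left_mono) auto
        moreover have "0 \<le> dens j \<omega> x / (1 + ?d * rt j \<omega> x)" using pos 2 by simp
        moreover have "?d * (dens j \<omega> x * rt j \<omega> x / (1 + ?d * rt j \<omega> x)) =
            dens j \<omega> x - dens j \<omega> x / (1 + ?d * rt j \<omega> x)"
          using pos by (simp add: field_simps)
        ultimately show ?thesis by (simp only: abs_of_nonneg simp_thms)
      qed simp
    qed
    have int: "integrable ?N (\<lambda>x. dens j \<omega> x / (1 + ?d * rt j \<omega> x))"
    proof (rule Bochner_Integration.integrable_bound)
      show "integrable ?N (\<lambda>x. dens j \<omega> x / flr G)" using elim(1) by simp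
      show "AE x in ?N. norm (dens j \<omega> x / (1 + ?d * rt j \<omega> x)) \<le> norm (dens j \<omega> x / flr G)"
        using ae
        by (rule eventually_mono) (simp only: real_norm_def, elim conjE, erule order_trans, rule abs_ge_self)
    qed measurable
    have "?d * (LINT x|?N. dens j \<omega> x * rt j \<omega> x / (1 + ?d * rt j \<omega> x)) =
        (LINT x|?N. ?d * (dens j \<omega> x * rt j \<omega> x / (1 + ?d * rt j \<omega> x)))"
      by (rule integral_mult_right_zero[symmetric])
    also have "\<dots> = (LINT x|?N. dens j \<omega> x - dens j \<omega> x / (1 + ?d * rt j \<omega> x))"
      by (rule integral_cong_AE) (use ae in \<open>auto elim: eventually_mono\<close>)
    also have "\<dots> = 1 - (LINT x|?N. dens j \<omega> x / (1 + ?d * rt j \<omega> x))"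
      using elim(1) int by simp
    finally show ?case by (simp add: calib_of_def)
  qed
qed

lemma calib_of_probability_iff:
  assumes D: "string_functions G D" "cond_i2 G D"
  shows "(AE \<omega> in M. (LINT x|ref G (Suc j). calib_of G D (Suc j) (past G j \<omega>) x) = 1) \<longleftrightarrow>
    (AE \<omega> in M. D j (past G j \<omega>) = 0 \<or>
      (LINT x|ref G (Suc j). dens j \<omega> x * rt j \<omega> x / (1 + D j (past G j \<omega>) * rt j \<omega> x)) = 0)"
proof -
  have "AE \<omega> in M. (LINT x|ref G (Suc j). calib_of G D (Suc j) (past G j \<omega>) x) = 1 \<longleftrightarrow>
      (D j (past G j \<omega>) = 0 \<or>
      (LINT x|ref G (Suc j). dens j \<omega> x * rt j \<omega> x / (1 + D j (past G j \<omega>) * rt j \<omega> x)) = 0)"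
    using calib_of_mass[OF D, of j] by eventually_elim auto
  then show ?thesis by (auto elim: eventually_elim2)
qed

section \<open>Optimal proportional investment\<close>

text \<open>
  The integrand \<open>\<phi> f g / (1 + d g)\<close> is decreasing in \<open>d\<close>, strictly so where \<open>\<phi> f g \<noteq> 0\<close>: its
  values at two fractions \<open>d\<close> and \<open>d'\<close> differ by \<open>(d' - d) * s\<close> with \<open>s \<ge> 0\<close>.
  As both integrals are 0, so is \<open>s\<close> almost everywhere if \<open>d \<noteq> d'\<close>.
\<close>

lemma i3A_unique:
  assumes nd: "nondegenerate G"
    and D: "string_functions G D" "cond_i2 G D" and D': "string_functions G D'" "cond_i2 G D'"
  shows "AE \<omega> in M. cond_i3A G j (past G j \<omega>) (D j (past G j \<omega>)) \<and>
    cond_i3A G j (past G j \<omega>) (D' j (past G j \<omega>)) \<longrightarrow> D j (past G j \<omega>) = D' j (past G j \<omega>)"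
proof -
  have nd': "AE \<omega> in M. \<not> (AE x in ref G (Suc j). wt j \<omega> x * dens j \<omega> x * rt j \<omega> x = 0)"
    using nd by (simp add: nondegenerate_def)
  then show ?thesis
    using string_fraction_floor[OF D, of j] string_fraction_floor[OF D', of j] AE_space
  proof (eventually_elim, intro impI)
    fix \<omega>
    assume nz: "\<not> (AE x in ref G (Suc j). wt j \<omega> x * dens j \<omega> x * rt j \<omega> x = 0)"
      and fl: "AE x in ref G (Suc j). 0 < dens j \<omega> x \<longrightarrow> flr G \<le> 1 + D j (past G j \<omega>) * rt j \<omega> x"
        "AE x in ref G (Suc j). 0 < dens j \<omega> x \<longrightarrow> flr G \<le> 1 + D' j (past G j \<omega>) * rt j \<omega> x"
      and \<omega>: "\<omega> \<in> space M"
      and i3A: "cond_i3A G j (past G j \<omega>) (D j (past G j \<omega>)) \<and>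
        cond_i3A G j (past G j \<omega>) (D' j (past G j \<omega>))"
    let ?N = "ref G (Suc j)" and ?d = "D j (past G j \<omega>)" and ?d' = "D' j (past G j \<omega>)"
    let ?i = "i3_integrand G j (past G j \<omega>)"
    show "?d = ?d'"
    proof (rule ccontr)
      assume ne: "?d \<noteq> ?d'"
      define s where "s x = wt j \<omega> x * dens j \<omega> x * (rt j \<omega> x)\<^sup>2 / ((1 + ?d * rt j \<omega> x) * (1 + ?d' * rt j \<omega> x))" for x
      note [measurable] = section_measurable[OF \<omega>]
      have facts: "AE x in ?N. 0 \<le> s x \<and> ?i ?d x - ?i ?d' x = (?d' - ?d) * s x \<and>
          (s x = 0 \<longrightarrow> wt j \<omega> x * dens j \<omega> x * rt j \<omega> x = 0)"
        using fl AE_space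
      proof eventually_elim
        case (elim x)
        have nn: "0 \<le> dens j \<omega> x" "0 \<le> wt j \<omega> x"
          using dens_nonneg wt_nonneg elim(3) \<omega> by auto
        show ?case
        proof (cases "dens j \<omega> x = 0")
          case False
          then have "0 < 1 + ?d * rt j \<omega> x" "0 < 1 + ?d' * rt j \<omega> x"
            using elim nn flr_pos by auto
          moreover from this have "?i ?d x - ?i ?d' x = (?d' - ?d) * s x"
            by (simp add: i3_integrand_def s_def field_simps power2_eq_square)
          ultimately show ?thesis
            using nn by (auto simp: s_def)
        qed (auto simp: s_def i3_integrand_def)
      qed
      have d_int: "integrable ?N (\<lambda>x. ?i ?d x - ?i ?d' x)" "(LINT x|?N. ?i ?d x - ?i ?d' x) = 0"
        using i3A by (auto simp: cond_i3A_def)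
      have m: "s \<in> borel_measurable ?N" unfolding s_def[abs_def] by measurable
      have "integrable ?N (\<lambda>x. (?d' - ?d) * s x)"
        using d_int(1) facts m
        by (subst integrable_cong_AE[where g = "\<lambda>x. ?i ?d x - ?i ?d' x"]) (auto elim: eventually_mono)
      then have s_int: "integrable ?N s" using ne by simp
      have "(LINT x|?N. (?d' - ?d) * s x) = (LINT x|?N. ?i ?d x - ?i ?d' x)"
        using d_int(1) facts m by (intro integral_cong_AE) (auto elim: eventually_mono)
      then have "(LINT x|?N. s x) = 0" using d_int(2) ne by simp
      moreover have "AE x in ?N. 0 \<le> s x" using facts by (rule eventually_mono) simp
      ultimately have "AE x in ?N. s x = 0"
        using integral_nonneg_eq_0_iff_AE[OF s_int] by simp
      then have "AE x in ?N. wt j \<omega> x * dens j \<omega> x * rt j \<omega> x = 0"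
        using facts by eventually_elim simp
      with nz show False by simp
    qed
  qed
qed

lemma D_opt_measurable:
  assumes D: "string_functions G D"
  shows "string_functions G (D_opt G D)"
  unfolding string_functions_def
proof
  fix j
  interpret N: sigma_finite_measure "ref G (Suc j)" by (rule ref_sigma_finite)
  have *: "(\<lambda>(h, x). u (Suc j) h x) \<in> borel_measurable (strings G j \<Otimes>\<^sub>M ref G (Suc j))"
    if "step_measurable G u" for u
    using that by (simp add: step_measurable_def)
  note [measurable] = *[OF cdens_measurable] *[OF wgt_measurable] *[OF ret_measurable]
  have [measurable]: "D j \<in> borel_measurable (strings G j)"
    using D by (simp add: string_functions_def)
  have i: "(\<lambda>(h, x). i3_integrand G j h (D j h) x) \<in> borel_measurable (strings G j \<Otimes>\<^sub>M ref G (Suc j))"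
    unfolding i3_integrand_def by measurable
  note [measurable] = N.borel_measurable_lebesgue_integrable[OF i] N.borel_measurable_lebesgue_integral[OF i]
  show "D_opt G D j \<in> borel_measurable (strings G j)"
    unfolding D_opt_def[abs_def] cond_i3A_def by measurable
qed

text \<open>
  Where \<open>D > 0\<close>, \<open>cond_i3\<close> makes the integral vanish, so no positive value of \<open>D\<close> is discarded;
  where \<open>D = 0\<close> both sides are 0. In particular the bound \<open>1 + D g \<ge> b\<close> is inherited, even for
  \<open>b > 1\<close>, when not investing is excluded.
\<close>

lemma D_opt_eq:
  assumes "cond_i1 G D" "cond_i3 G D"
  shows "AE \<omega> in M. D_opt G D j (past G j \<omega>) = D j (past G j \<omega>)"
proof -
  have "AE \<omega> in M. 0 \<le> D j (past G j \<omega>) \<and> D j (past G j \<omega>) < 1"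
    using assms(1) by (simp add: cond_i1_def)
  moreover have "AE \<omega> in M.
     integrable (ref G (Suc j)) (i3_integrand G j (past G j \<omega>) (D j (past G j \<omega>))) \<and>
     D j (past G j \<omega>) * (LINT x|ref G (Suc j). i3_integrand G j (past G j \<omega>) (D j (past G j \<omega>)) x) = 0"
    using assms(2) by (simp add: cond_i3_def)
  ultimately show ?thesis
    by eventually_elim (auto simp: D_opt_def cond_i3A_def)
qed

lemma D_opt_conditions:
  assumes "cond_i1 G D" "cond_i2 G D" "cond_i3 G D"
  shows "cond_i1 G (D_opt G D)" "cond_i2 G (D_opt G D)" "cond_i3 G (D_opt G D)"
proof -
  note eq = D_opt_eq[OF assms(1,3)]
  show "cond_i1 G (D_opt G D)"
    unfolding cond_i1_def
  proof
    fix j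
    have "AE \<omega> in M. 0 \<le> D j (past G j \<omega>) \<and> D j (past G j \<omega>) < 1"
      using assms(1) by (simp add: cond_i1_def)
    then show "AE \<omega> in M. 0 \<le> D_opt G D j (past G j \<omega>) \<and> D_opt G D j (past G j \<omega>) < 1"
      using eq[of j] by eventually_elim simp
  qed
  show "cond_i2 G (D_opt G D)"
    unfolding cond_i2_def
  proof
    fix j
    have "AE \<omega> in M. flr G \<le> 1 + D j (past G j \<omega>) * rt j \<omega> (trial G (Suc j) \<omega>)"
      using assms(2) by (simp add: cond_i2_def)
    then show "AE \<omega> in M. flr G \<le> 1 + D_opt G D j (past G j \<omega>) * rt j \<omega> (trial G (Suc j) \<omega>)"
      using eq[of j] by eventually_elim simp
  qed
  show "cond_i3 G (D_opt G D)"
    unfolding cond_i3_def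
  proof
    fix j
    have "AE \<omega> in M. integrable (ref G (Suc j)) (i3_integrand G j (past G j \<omega>) (D j (past G j \<omega>))) \<and>
        D j (past G j \<omega>) * (LINT x|ref G (Suc j). i3_integrand G j (past G j \<omega>) (D j (past G j \<omega>)) x) = 0"
      using assms(3) by (simp add: cond_i3_def)
    then show "AE \<omega> in M.
        integrable (ref G (Suc j)) (i3_integrand G j (past G j \<omega>) (D_opt G D j (past G j \<omega>))) \<and>
        D_opt G D j (past G j \<omega>) *
          (LINT x|ref G (Suc j). i3_integrand G j (past G j \<omega>) (D_opt G D j (past G j \<omega>)) x) = 0"
      using eq[of j] by eventually_elim simp
  qed
qed

lemma calib_of_i3_integrand:
  "wt j \<omega> x * calib_of G D (Suc j) (past G j \<omega>) x * rt j \<omega> x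
    = i3_integrand G j (past G j \<omega>) (D j (past G j \<omega>)) x"
  by (simp add: calib_of_def i3_integrand_def)

lemma prop_capital_pos:
  assumes "cond_i2 G D"
  shows "AE \<omega> in M. 0 < prop_capital G D n \<omega>"
proof (induction n)
  case 0
  show ?case using capital0_pos by simp
next
  case (Suc n)
  have "AE \<omega> in M. flr G \<le> 1 + D n (past G n \<omega>) * rt n \<omega> (trial G (Suc n) \<omega>)"
    using assms by (simp add: cond_i2_def)
  with Suc show ?case
    by eventually_elim (use flr_pos in auto)
qed

lemma prop_policy_a0:
  assumes "string_functions G D"
  shows "cond_a0 G (prop_policy G D)"
proof -
  have cap: "prop_capital G D n \<in> borel_measurable (info G n)" for n
  proof (induction n)
    case 0
    have "prop_capital G D 0 = capital0 G" by (rule ext) simp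
    then show ?case using capital0_info[of 0] by simp
  next
    case (Suc n)
    have [measurable]: "prop_capital G D n \<in> borel_measurable (info G (Suc n))"
      by (rule measurable_info_mono[OF _ Suc]) simp
    have [measurable]: "(\<lambda>\<omega>. D n (past G n \<omega>)) \<in> borel_measurable (info G (Suc n))"
      by (rule measurable_info_mono[OF _ string_function_info[OF assms]]) simp
    note [measurable] = step_realised[OF ret_measurable, of n]
    have "prop_capital G D (Suc n) = (\<lambda>\<omega>. prop_capital G D n \<omega> *
        (1 + D n (past G n \<omega>) * rt n \<omega> (trial G (Suc n) \<omega>)))"
      by (rule ext) simp
    then show ?case by simp
  qed
  show ?thesis
    unfolding cond_a0_def prop_policy_def[abs_def]
    using cap string_function_info[OF assms] by (intro allI borel_measurable_times) auto
qed

lemma prop_policy_a1: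
  assumes "cond_i1 G D" "cond_i2 G D"
  shows "cond_a1 G (prop_policy G D)"
  unfolding cond_a1_def
proof
  fix j
  have "AE \<omega> in M. 0 \<le> D j (past G j \<omega>) \<and> D j (past G j \<omega>) < 1"
    using assms(1) by (simp add: cond_i1_def)
  then show "AE \<omega> in M. 0 \<le> prop_policy G D j \<omega> \<and> prop_policy G D j \<omega> < capital G (prop_policy G D) j \<omega>"
    using prop_capital_pos[OF assms(2), of j]
    by eventually_elim (simp add: capital_prop_policy prop_policy_def)
qed

lemma prop_policy_a2:
  assumes "cond_i2 G D"
  shows "cond_a2 G (prop_policy G D)"
  unfolding cond_a2_def
proof
  fix j
  have "AE \<omega> in M. flr G \<le> 1 + D j (past G j \<omega>) * rt j \<omega> (trial G (Suc j) \<omega>)"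
    using assms by (simp add: cond_i2_def)
  then show "AE \<omega> in M. flr G \<le> 1 + prop_policy G D j \<omega> * rt j \<omega> (trial G (Suc j) \<omega>) /
      capital G (prop_policy G D) j \<omega>"
    using prop_capital_pos[OF assms, of j]
    by eventually_elim (simp add: capital_prop_policy prop_policy_def)
qed

lemma prop_policy_a3:
  assumes "cond_i3 G D"
  shows "cond_a3 G (calib_of G D) (prop_policy G D)"
  unfolding cond_a3_def calib_of_i3_integrand
proof
  fix j
  have "AE \<omega> in M. integrable (ref G (Suc j)) (i3_integrand G j (past G j \<omega>) (D j (past G j \<omega>))) \<and>
      D j (past G j \<omega>) * (LINT x|ref G (Suc j). i3_integrand G j (past G j \<omega>) (D j (past G j \<omega>)) x) = 0"
    using assms by (simp add: cond_i3_def)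
  then show "AE \<omega> in M. integrable (ref G (Suc j)) (\<lambda>x. i3_integrand G j (past G j \<omega>) (D j (past G j \<omega>)) x) \<and>
      prop_policy G D j \<omega> *
        (LINT x|ref G (Suc j). i3_integrand G j (past G j \<omega>) (D j (past G j \<omega>)) x) = 0"
    by eventually_elim (auto simp: prop_policy_def)
qed

lemma prop_policy_S_sum:
  assumes "cond_i1 G D" "cond_i2 G D"
  shows "AE \<omega> in M. S_sum G (prop_policy G D) n \<omega> = (\<Sum>j<n. log_term G D j \<omega>)"
proof -
  have "AE \<omega> in M. \<forall>j. 0 < prop_capital G D j \<omega>"
    unfolding AE_all_countable using prop_capital_pos[OF assms(2)] by blast
  then show ?thesis
  proof eventually_elim
    case (elim \<omega>)
    have "capital G (prop_policy G D) (Suc j) \<omega> / capital G (prop_policy G D) j \<omega> =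
        1 + D j (past G j \<omega>) * rt j \<omega> (trial G (Suc j) \<omega>)" for j
    proof -
      have "prop_capital G D j \<omega> \<noteq> 0" using elim[rule_format, of j] by simp
      then show ?thesis by (simp only: capital_prop_policy prop_capital.simps) simp
    qed
    then show ?case by (simp add: S_sum_def log_term_def del: capital.simps)
  qed
qed

lemma prop_policy_S:
  assumes "string_functions G D" "cond_i1 G D" "cond_i2 G D" "beta_converges G D"
  shows "S_converges G (prop_policy G D)"
    and "(LINT \<omega>|M. S_sum G (prop_policy G D) n \<omega>) = E_sum G D n"
proof -
  have l: "integrable M (log_term G D j)" for j
    using assms(4) by (simp add: beta_converges_def)
  have m: "S_sum G (prop_policy G D) n \<in> borel_measurable M" for n
    by (rule measurable_info_M[OF S_sum_info[OF prop_policy_a0[OF assms(1)]]])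
  have eq: "AE \<omega> in M. S_sum G (prop_policy G D) n \<omega> = (\<Sum>j<n. log_term G D j \<omega>)" for n
    by (rule prop_policy_S_sum[OF assms(2,3)])
  have "integrable M (S_sum G (prop_policy G D) n)" for n
    using l m[of n] eq[of n] by (subst integrable_cong_AE) (auto intro!: borel_measurable_sum)
  then show "S_converges G (prop_policy G D)" by (simp add: S_converges_def)
  have "(LINT \<omega>|M. S_sum G (prop_policy G D) n \<omega>) = (LINT \<omega>|M. (\<Sum>j<n. log_term G D j \<omega>))"
    using l m[of n] eq[of n] by (intro integral_cong_AE) (auto intro!: borel_measurable_sum)
  also have "\<dots> = E_sum G D n"
    using l by (simp add: E_sum_def beta_def)
  finally show "(LINT \<omega>|M. S_sum G (prop_policy G D) n \<omega>) = E_sum G D n" .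
qed

lemma log_term_growth:
  assumes "string_functions G D" "beta_converges G D"
  shows "AE \<omega> in M. integrable (ref G (Suc j))
      (\<lambda>x. wt j \<omega> x * dens j \<omega> x * ln (1 + D j (past G j \<omega>) * rt j \<omega> x))"
    and "AE \<omega> in M. real_cond_exp M (info G j) (log_term G D j) \<omega> = growth G j (past G j \<omega>) (D j (past G j \<omega>))"
  using cond_exp_log_return[OF string_function_info[OF assms(1)], of j] assms(2)
  by (auto simp: beta_converges_def log_term_def[abs_def])

text \<open>
  \<open>\<phi> f / (1 + D g) = \<phi> f - D \<phi> f g / (1 + D g)\<close>, and the last term has integral 0, so
  \<open>cond_qf\<close> holds with equality.
\<close>

lemma calib_of_qf:
  assumes D: "string_functions G D" "cond_i2 G D" "cond_i3 G D"
  shows "cond_qf G (calib_of G D)"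
  unfolding cond_qf_def
proof
  fix j
  let ?N = "ref G (Suc j)"
  have i3: "AE \<omega> in M. integrable ?N (i3_integrand G j (past G j \<omega>) (D j (past G j \<omega>))) \<and>
      D j (past G j \<omega>) * (LINT x|?N. i3_integrand G j (past G j \<omega>) (D j (past G j \<omega>)) x) = 0"
    using D(3) by (simp add: cond_i3_def)
  show "AE \<omega> in M. integrable ?N (\<lambda>x. wt j \<omega> x * calib_of G D (Suc j) (past G j \<omega>) x) \<and>
      (LINT x|?N. wt j \<omega> x * calib_of G D (Suc j) (past G j \<omega>) x)
        \<le> real_cond_exp M (info G j) (\<lambda>\<omega>'. wt j \<omega>' (trial G (Suc j) \<omega>')) \<omega>"
    using i3 string_fraction_floor[OF D(1,2), of j] wt_dens_integral[of j] AE_space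
  proof eventually_elim
    case (elim \<omega>)
    let ?d = "D j (past G j \<omega>)"
    let ?i = "i3_integrand G j (past G j \<omega>) ?d"
    note [measurable] = section_measurable[OF elim(5)]
    have ae: "AE x in ?N. wt j \<omega> x * calib_of G D (Suc j) (past G j \<omega>) x = wt j \<omega> x * dens j \<omega> x - ?d * ?i x"
      using elim(2) AE_space
    proof eventually_elim
      case (elim x)
      have "0 \<le> dens j \<omega> x" using dens_nonneg elim(2) \<open>\<omega> \<in> space M\<close> by auto
      then consider "dens j \<omega> x = 0" | "0 < dens j \<omega> x" by linarith
      then show ?case
      proof cases
        case 2
        then have "0 < 1 + ?d * rt j \<omega> x" using elim flr_pos by simp
        then show ?thesis by (simp add: calib_of_def i3_integrand_def field_simps)
      qed (simp add: calib_of_def i3_integrand_def)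
    qed
    have m: "(\<lambda>x. wt j \<omega> x * calib_of G D (Suc j) (past G j \<omega>) x) \<in> borel_measurable ?N"
      "?i \<in> borel_measurable ?N"
      unfolding calib_of_def[abs_def] i3_integrand_def[abs_def] by measurable
    have int: "integrable ?N (\<lambda>x. wt j \<omega> x * dens j \<omega> x - ?d * ?i x)"
      using elim by simp
    have "integrable ?N (\<lambda>x. wt j \<omega> x * calib_of G D (Suc j) (past G j \<omega>) x)"
      using int ae m by (subst integrable_cong_AE) auto
    moreover have "(LINT x|?N. wt j \<omega> x * calib_of G D (Suc j) (past G j \<omega>) x)
        = (LINT x|?N. wt j \<omega> x * dens j \<omega> x - ?d * ?i x)"
      using int ae m by (intro integral_cong_AE) auto
    moreover have "\<dots> = (LINT x|?N. wt j \<omega> x * dens j \<omega> x)"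
      using elim by simp
    ultimately show ?case using elim by simp
  qed
qed

text \<open>
  For \<open>q = f / (1 + D g)\<close> the ratio \<open>f / q\<close> is the capital ratio of the proportional policy.
\<close>

lemma calib_of_alpha:
  assumes D: "string_functions G D" "cond_i2 G D" "beta_converges G D"
  shows "AE \<omega> in M. integrable (ref G (Suc j)) (alpha_integrand G (calib_of G D) j (past G j \<omega>)) \<and>
    alpha G (calib_of G D) j \<omega> = growth G j (past G j \<omega>) (D j (past G j \<omega>))"
  using string_fraction_floor[OF D(1,2), of j] log_term_growth(1)[OF D(1,3), of j] AE_space
proof eventually_elim
  case (elim \<omega>)
  let ?N = "ref G (Suc j)" and ?d = "D j (past G j \<omega>)"
  note [measurable] = section_measurable[OF elim(3)]
  have ae: "AE x in ?N. alpha_integrand G (calib_of G D) j (past G j \<omega>) x =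
      wt j \<omega> x * dens j \<omega> x * ln (1 + ?d * rt j \<omega> x)"
    using elim(1) AE_space
  proof eventually_elim
    case (elim x)
    have "0 \<le> dens j \<omega> x" using dens_nonneg elim(2) \<open>\<omega> \<in> space M\<close> by auto
    then consider "dens j \<omega> x = 0" | "0 < dens j \<omega> x" by linarith
    then show ?case
      by cases (simp_all add: alpha_integrand_def calib_of_def)
  qed
  have m: "alpha_integrand G (calib_of G D) j (past G j \<omega>) \<in> borel_measurable ?N"
    unfolding alpha_integrand_def[abs_def] calib_of_def[abs_def] by measurable
  have "integrable ?N (alpha_integrand G (calib_of G D) j (past G j \<omega>))"
    using elim(2) ae m by (subst integrable_cong_AE) auto
  moreover have "alpha G (calib_of G D) j \<omega> = growth G j (past G j \<omega>) ?d"
    unfolding alpha_def growth_def using ae m by (intro integral_cong_AE) auto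
  ultimately show ?case by simp
qed

text \<open>
  \<open>growth_le_alpha\<close> with \<open>q = f / (1 + D g)\<close> bounds the conditional mean of each increment of \<open>S\<close>
  by the growth of the proportional policy. This \<open>q\<close> vanishes together with \<open>f\<close>, so outcomes of
  density 0 contribute nothing to the bound.
\<close>

lemma prop_policy_maximal:
  assumes D: "string_functions G D" "cond_i1 G D" "cond_i2 G D" "cond_i3 G D" "beta_converges G D"
    and C: "cond_a0 G C" "cond_a1 G C" "cond_a2 G C" "cond_a3 G (calib_of G D) C" "S_converges G C"
  shows "(LINT \<omega>|M. S_sum G C n \<omega>) \<le> E_sum G D n"
proof -
  have step: "(LINT \<omega>|M. S_sum G C (Suc j) \<omega> - S_sum G C j \<omega>) \<le> beta G D j" for j
  proof -
    interpret step: disintegration M "ref G (Suc j)" "info G j" "trial G (Suc j)" "dens j"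
      by (rule disintegration_step)
    have q_pos: "AE \<omega> in M. AE x in ref G (Suc j). 0 < dens j \<omega> x \<longrightarrow>
        0 < calib_of G D (Suc j) (past G j \<omega>) x"
      using string_fraction_floor[OF D(1,3), of j]
      by eventually_elim (erule eventually_mono, use flr_pos in \<open>auto simp: calib_of_def\<close>)
    have null: "AE \<omega> in M. AE x in ref G (Suc j). dens j \<omega> x = 0 \<longrightarrow>
        0 \<le> wt j \<omega> x * calib_of G D (Suc j) (past G j \<omega>) x * (1 + fraction G C j \<omega> * rt j \<omega> x)"
      by (simp add: calib_of_def)
    have alpha: "AE \<omega> in M. integrable (ref G (Suc j)) (alpha_integrand G (calib_of G D) j (past G j \<omega>))"
      using calib_of_alpha[OF D(1,3,5), of j] by (rule eventually_mono) simp
    have int: "integrable M (\<lambda>\<omega>. S_sum G C (Suc j) \<omega> - S_sum G C j \<omega>)" "integrable M (log_term G D j)"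
      using C(5) D(5) by (auto simp: S_converges_def beta_converges_def)
    have "AE \<omega> in M. real_cond_exp M (info G j) (\<lambda>\<omega>. S_sum G C (Suc j) \<omega> - S_sum G C j \<omega>) \<omega>
        \<le> real_cond_exp M (info G j) (log_term G D j) \<omega>"
      using growth_le_alpha(1)[OF C calib_of_qf[OF D(1,3,4)] alpha q_pos null]
        calib_of_alpha[OF D(1,3,5), of j] strategy_growth(2)[OF C(1,2,5), of j]
        log_term_growth(2)[OF D(1,5), of j]
      by eventually_elim simp
    then have "(LINT \<omega>|M. real_cond_exp M (info G j) (\<lambda>\<omega>. S_sum G C (Suc j) \<omega> - S_sum G C j \<omega>) \<omega>)
        \<le> (LINT \<omega>|M. real_cond_exp M (info G j) (log_term G D j) \<omega>)"
      using int by (intro integral_mono_AE step.real_cond_exp_int)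
    then show ?thesis
      using int by (simp add: step.real_cond_exp_int beta_def)
  qed
  show ?thesis
  proof (induction n)
    case 0
    show ?case by (simp add: S_sum_def E_sum_def)
  next
    case (Suc n)
    have "(LINT \<omega>|M. S_sum G C (Suc n) \<omega> - S_sum G C n \<omega>) =
        (LINT \<omega>|M. S_sum G C (Suc n) \<omega>) - (LINT \<omega>|M. S_sum G C n \<omega>)"
      using C(5) by (intro Bochner_Integration.integral_diff) (auto simp: S_converges_def)
    then show ?case
      using Suc step[of n] by (simp add: E_sum_def)
  qed
qed

text \<open>
  For positive \<open>D\<close> the integral in \<open>cond_a3\<close> vanishes by itself, whatever the stake.
\<close>

lemma calib_of_a3:
  assumes D: "string_functions G D" "cond_i3 G D"
    and pos: "\<And>j. AE \<omega> in M. 0 < D j (past G j \<omega>)"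
  shows "cond_a3 G (calib_of G D) C"
  unfolding cond_a3_def calib_of_i3_integrand
proof
  fix j
  have "AE \<omega> in M. integrable (ref G (Suc j)) (i3_integrand G j (past G j \<omega>) (D j (past G j \<omega>))) \<and>
      D j (past G j \<omega>) * (LINT x|ref G (Suc j). i3_integrand G j (past G j \<omega>) (D j (past G j \<omega>)) x) = 0"
    using D(2) by (simp add: cond_i3_def)
  then show "AE \<omega> in M. integrable (ref G (Suc j)) (\<lambda>x. i3_integrand G j (past G j \<omega>) (D j (past G j \<omega>)) x) \<and>
      C j \<omega> * (LINT x|ref G (Suc j). i3_integrand G j (past G j \<omega>) (D j (past G j \<omega>)) x) = 0"
    using pos[of j] by eventually_elim auto
qed

end

section \<open>Supermartingales, martingales and maximal growth\<close>

theorem theorem4p1: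
  fixes G :: "('w, 'x) betting"
    and q :: "nat \<Rightarrow> (nat \<Rightarrow> 'x) \<Rightarrow> 'x \<Rightarrow> real"
  assumes "betting_model G"
    and "calibrating G q"
    and "cond_qf G q"
    and "alpha_converges G q"
  shows
    \<comment> \<open>(a)\<close>
    "(\<forall>C. cond_a0 G C \<and> cond_a1 G C \<and> cond_a2 G C \<and> cond_a2_null G q C \<and> cond_a3 G q C \<and>
        S_converges G C \<longrightarrow>
          supermartingale (prb G) (info G) (\<lambda>n \<omega>. S_sum G C n \<omega> - A_sum G q n \<omega>) \<and>
          (\<forall>n. (LINT \<omega>|prb G. S_sum G C n \<omega>) \<le> (LINT \<omega>|prb G. A_sum G q n \<omega>)))
     \<and>
     \<comment> \<open>(b)\<close>
     (\<forall>C. cond_a0 G C \<and> cond_a1 G C \<and> cond_a2 G C \<and> cond_a2_null G q C \<and> cond_a3 G q C \<and>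
        S_converges G C \<longrightarrow>
          (nondegenerate G \<longrightarrow>
            (martingale (prb G) (info G) (\<lambda>n \<omega>. S_sum G C n \<omega> - A_sum G q n \<omega>) \<longleftrightarrow>
              (\<exists>D. string_functions G D \<and> cond_i1 G D \<and> cond_i2 G D \<and> cond_i3 G D \<and>
                 cond_i4 G q D \<and> cond_ii G D C))) \<and>
          ((\<exists>D. string_functions G D \<and> cond_i1 G D \<and> cond_i2 G D \<and> cond_i3 G D \<and>
                 cond_i4 G q D \<and> cond_ii G D C) \<longrightarrow>
            martingale (prb G) (info G) (\<lambda>n \<omega>. S_sum G C n \<omega> - A_sum G q n \<omega>)) \<and>
          (martingale (prb G) (info G) (\<lambda>n \<omega>. S_sum G C n \<omega> - A_sum G q n \<omega>) \<longrightarrow>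
            (\<forall>n. (LINT \<omega>|prb G. S_sum G C n \<omega>) = (LINT \<omega>|prb G. A_sum G q n \<omega>))))
     \<and>
     \<comment> \<open>(b), when the calibrating function is a density\<close>
     (\<forall>D. string_functions G D \<and> cond_i1 G D \<and> cond_i2 G D \<and> cond_i3 G D \<longrightarrow>
        (\<forall>j. (AE \<omega> in prb G.
                (LINT x|ref G (Suc j). calib_of G D (Suc j) (past G j \<omega>) x) = 1)
           \<longleftrightarrow>
             (AE \<omega> in prb G. D j (past G j \<omega>) = 0 \<or>
                (LINT x|ref G (Suc j). cdens G (Suc j) (past G j \<omega>) x *
                   ret G (Suc j) (past G j \<omega>) x /
                   (1 + D j (past G j \<omega>) * ret G (Suc j) (past G j \<omega>) x)) = 0)))
     \<and>
     \<comment> \<open>(c), uniqueness of the positive value\<close>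
     (\<forall>D D'. nondegenerate G \<and>
        string_functions G D \<and> cond_i1 G D \<and> cond_i2 G D \<and> cond_i3 G D \<and>
        string_functions G D' \<and> cond_i1 G D' \<and> cond_i2 G D' \<and> cond_i3 G D' \<longrightarrow>
        (\<forall>j. AE \<omega> in prb G.
           cond_i3A G j (past G j \<omega>) (D j (past G j \<omega>)) \<and> 0 < D j (past G j \<omega>) \<and>
           cond_i3A G j (past G j \<omega>) (D' j (past G j \<omega>)) \<and> 0 < D' j (past G j \<omega>) \<longrightarrow>
           D j (past G j \<omega>) = D' j (past G j \<omega>)))
     \<and>
     \<comment> \<open>(c)\<close>
     (\<forall>D. string_functions G D \<and> cond_i1 G D \<and> cond_i2 G D \<and> cond_i3 G D \<and>
        beta_converges G (D_opt G D) \<longrightarrow>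
          cond_a0 G (prop_policy G (D_opt G D)) \<and>
          cond_a1 G (prop_policy G (D_opt G D)) \<and>
          cond_a2 G (prop_policy G (D_opt G D)) \<and>
          cond_a3 G (calib_of G (D_opt G D)) (prop_policy G (D_opt G D)) \<and>
          S_converges G (prop_policy G (D_opt G D)) \<and>
          (\<forall>n. (LINT \<omega>|prb G. S_sum G (prop_policy G (D_opt G D)) n \<omega>) = E_sum G (D_opt G D) n) \<and>
          (\<forall>C. cond_a0 G C \<and> cond_a1 G C \<and> cond_a2 G C \<and> cond_a3 G (calib_of G (D_opt G D)) C \<and>
             S_converges G C \<longrightarrow>
             (\<forall>n. (LINT \<omega>|prb G. S_sum G C n \<omega>) \<le> E_sum G (D_opt G D) n)))
     \<and>
     \<comment> \<open>(d)\<close>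
     (\<forall>D. string_functions G D \<and> cond_i1 G D \<and> cond_i2 G D \<and> cond_i3 G D \<and>
        beta_converges G (D_opt G D) \<and>
        (\<forall>j. AE \<omega> in prb G. 0 < D_opt G D j (past G j \<omega>)) \<longrightarrow>
          cond_a0 G (prop_policy G (D_opt G D)) \<and>
          cond_a1 G (prop_policy G (D_opt G D)) \<and>
          cond_a2 G (prop_policy G (D_opt G D)) \<and>
          S_converges G (prop_policy G (D_opt G D)) \<and>
          (\<forall>C. cond_a0 G C \<and> cond_a1 G C \<and> cond_a2 G C \<and> S_converges G C \<longrightarrow>
             (\<forall>n. (LINT \<omega>|prb G. S_sum G C n \<omega>)
                \<le> (LINT \<omega>|prb G. S_sum G (prop_policy G (D_opt G D)) n \<omega>))))"
proof -
  interpret betting_model G by fact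
  have q: "step_measurable G q" using assms(2) by (simp add: calibrating_def)
  have ex: "(\<lambda>n \<omega>. S_sum G C n \<omega> - A_sum G q n \<omega>) = excess q C" for C
    by (intro ext) (simp add: excess_def)
  show ?thesis
    unfolding ex
  proof (intro conjI allI impI; (elim conjE)?)
    fix C assume C: "cond_a0 G C" "cond_a1 G C" "cond_a2 G C" "cond_a2_null G q C" "cond_a3 G q C"
      "S_converges G C"
    show sup: "supermartingale M (info G) (excess q C)"
      by (rule excess_supermartingale[OF assms(2-4) C])
    show "(LINT \<omega>|M. S_sum G C n \<omega>) \<le> (LINT \<omega>|M. A_sum G q n \<omega>)" for n
      by (rule supermartingale_mean[OF sup C(6) assms(4)])
    have proportional: "martingale M (info G) (excess q C)"
      if "\<exists>D. string_functions G D \<and> cond_i1 G D \<and> cond_i2 G D \<and> cond_i3 G D \<and>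
        cond_i4 G q D \<and> cond_ii G D C"
      using that martingale_iff_growth[OF C(1,2,6) q assms(4)] proportional_growth[OF q _ _ _ _ C(2)]
      by blast
    then show "\<exists>D. string_functions G D \<and> cond_i1 G D \<and> cond_i2 G D \<and> cond_i3 G D \<and>
        cond_i4 G q D \<and> cond_ii G D C \<Longrightarrow> martingale M (info G) (excess q C)" .
    show "martingale M (info G) (excess q C) \<longleftrightarrow> (\<exists>D. string_functions G D \<and> cond_i1 G D \<and>
        cond_i2 G D \<and> cond_i3 G D \<and> cond_i4 G q D \<and> cond_ii G D C)" if "nondegenerate G"
      using proportional martingale_proportional[OF assms(2-4) C that] by blast
    show "(LINT \<omega>|M. S_sum G C n \<omega>) = (LINT \<omega>|M. A_sum G q n \<omega>)"
      if "martingale M (info G) (excess q C)" for n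
      by (rule martingale_mean[OF that C(6) assms(4)])
  next
    fix D j assume D: "string_functions G D" "cond_i2 G D"
    show "(AE \<omega> in M. (LINT x|ref G (Suc j). calib_of G D (Suc j) (past G j \<omega>) x) = 1) \<longleftrightarrow>
      (AE \<omega> in M. D j (past G j \<omega>) = 0 \<or> (LINT x|ref G (Suc j). dens j \<omega> x * rt j \<omega> x /
        (1 + D j (past G j \<omega>) * rt j \<omega> x)) = 0)"
      by (rule calib_of_probability_iff[OF D])
  next
    fix D D' j
    assume nd: "nondegenerate G" and D: "string_functions G D" "cond_i2 G D"
      and D': "string_functions G D'" "cond_i2 G D'"
    show "AE \<omega> in M. cond_i3A G j (past G j \<omega>) (D j (past G j \<omega>)) \<and> 0 < D j (past G j \<omega>) \<and>
        cond_i3A G j (past G j \<omega>) (D' j (past G j \<omega>)) \<and> 0 < D' j (past G j \<omega>) \<longrightarrow>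
        D j (past G j \<omega>) = D' j (past G j \<omega>)"
      using i3A_unique[OF nd D D', of j] by (rule eventually_mono) blast
  next
    fix D assume D: "string_functions G D" "cond_i1 G D" "cond_i2 G D" "cond_i3 G D"
      "beta_converges G (D_opt G D)"
    note O = D_opt_measurable[OF D(1)] D_opt_conditions[OF D(2-4)]
    let ?C = "prop_policy G (D_opt G D)"
    show "cond_a0 G ?C" "cond_a0 G ?C"
      by (rule prop_policy_a0[OF O(1)])+
    show "cond_a1 G ?C" "cond_a1 G ?C"
      by (rule prop_policy_a1[OF O(2,3)])+
    show "cond_a2 G ?C" "cond_a2 G ?C"
      by (rule prop_policy_a2[OF O(3)])+
    show "cond_a3 G (calib_of G (D_opt G D)) ?C"
      by (rule prop_policy_a3[OF O(4)])
    show "S_converges G ?C" "S_converges G ?C"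
      by (rule prop_policy_S(1)[OF O(1-3) D(5)])+
    show E: "(LINT \<omega>|M. S_sum G ?C n \<omega>) = E_sum G (D_opt G D) n" for n
      by (rule prop_policy_S(2)[OF O(1-3) D(5)])
    fix C n assume C: "cond_a0 G C" "cond_a1 G C" "cond_a2 G C" "S_converges G C"
    show max: "(LINT \<omega>|M. S_sum G C n \<omega>) \<le> E_sum G (D_opt G D) n"
      if "cond_a3 G (calib_of G (D_opt G D)) C"
      by (rule prop_policy_maximal[OF O D(5) C(1-3) that C(4)])
    show "(LINT \<omega>|M. S_sum G C n \<omega>) \<le> (LINT \<omega>|M. S_sum G ?C n \<omega>)"
      if "\<forall>j. AE \<omega> in M. 0 < D_opt G D j (past G j \<omega>)"
      using max[OF calib_of_a3[OF O(1,4)]] that E by simp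
  qed
qed

end
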